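(* Let $A\in\mathbb{R}^{m_1\times n_1}$, $a\in\mathbb{R}^{1\times n_1}$ with $a\neq 0$, $b\in\mathbb{R}^{1\times n_2}$ with $b\neq 0$, $B\in\mathbb{R}^{m_2\times n_2}$, $c_A\in\mathbb{R}^{m_1}$, $c_B\in\mathbb{R}^{m_2}$ and $c\in\mathbb{R}$. Consider the ($2$-sum) polyhedron \[ R=\{(x,y)\in\mathbb{R}^{n_1}\times\mathbb{R}^{n_2} : Ax=c_A,\ ax+by=c,\ By=c_B,\ x\ge 0,\ y\ge 0\}. \] Let $\bar A=\begin{bmatrix}A\\ a\end{bmatrix}$ and $\bar B=\begin{bmatrix}b\\ B\end{bmatrix}$. Then the combinatorial diameter of $R$ satisfies \[ d(R)\le d(A)\,(d(\bar A)+1)+d(B)\,(d(\bar B)+1)+\min\{d(\bar A)+d(B)+1,\ d(A)+d(\bar B)+1\}. \]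
   Context: The distance $d_P(v,w)$ between two vertices of a polyhedron $P$ is the minimum number of edges in an edge walk from $v$ to $w$ in the graph of $P$; the (combinatorial) diameter $d(P)$ is the maximum of $d_P(v,w)$ over all pairs of vertices. For a matrix $M\in\mathbb{R}^{m\times n}$, $d(M):=\max\{d(\{x: Mx=r,\ x\ge 0\}) : r\in\mathbb{R}^m\}$, i.e., the largest diameter of any standard-form polyhedron with equality constraint matrix $M$. *)

theory Defs
  imports "HOL-Analysis.Analysis" "HOL-Library.Extended_Nat"
begin

definition vertex_adj :: "'a::real_vector set \<Rightarrow> 'a \<Rightarrow> 'a \<Rightarrow> bool" where
  "vertex_adj P v w \<longleftrightarrow> v \<noteq> w \<and> v extreme_point_of P \<and> w extreme_point_of P
      \<and> closed_segment v w face_of P"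

definition edge_walk :: "'a::real_vector set \<Rightarrow> 'a list \<Rightarrow> bool" where
  "edge_walk P xs \<longleftrightarrow> xs \<noteq> [] \<and> (\<forall>i < length xs - 1. vertex_adj P (xs ! i) (xs ! Suc i))"

text \<open>Distance: minimum number of edges of a walk from v to w (infinity if none).\<close>
definition poly_dist :: "'a::real_vector set \<Rightarrow> 'a \<Rightarrow> 'a \<Rightarrow> enat" where
  "poly_dist P v w =
     (INF xs \<in> {xs. edge_walk P xs \<and> hd xs = v \<and> last xs = w}. enat (length xs - 1))"

text \<open>Combinatorial diameter: maximum distance over pairs of vertices (0 if no vertices).\<close>
definition poly_diam :: "'a::real_vector set \<Rightarrow> enat" where
  "poly_diam P =
     (SUP vw \<in> {(v, w). v extreme_point_of P \<and> w extreme_point_of P}. poly_dist P (fst vw) (snd vw))"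

definition std_poly :: "real^'n^'m \<Rightarrow> real^'m \<Rightarrow> (real^'n) set" where
  "std_poly M r = {x. M *v x = r \<and> (\<forall>i. 0 \<le> x $ i)}"

definition mat_diam :: "real^'n^'m \<Rightarrow> enat" where
  "mat_diam M = (SUP r. poly_diam (std_poly M r))"

definition stack_below :: "real^'n^'m \<Rightarrow> real^'n \<Rightarrow> real^'n^('m option)" where
  "stack_below A a = (\<chi> i. case i of None \<Rightarrow> a | Some j \<Rightarrow> A $ j)"

definition stack_above :: "real^'n \<Rightarrow> real^'n^'m \<Rightarrow> real^'n^('m option)" where
  "stack_above b B = (\<chi> i. case i of None \<Rightarrow> b | Some j \<Rightarrow> B $ j)"

end

theory Submission
  imports Defs
begin

text \<open>
  Put \<open>P = std_poly A cA\<close>, \<open>Q = std_poly B cB\<close>, \<open>f x = a \<bullet> x\<close> and \<open>g y = c - b \<bullet> y\<close>, so that \<open>R\<close>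
  is the set of pairs in \<open>P \<times> Q\<close> on which the levels \<open>f\<close> and \<open>g\<close> agree.  At a vertex \<open>(x, y)\<close> of
  \<open>R\<close>, one component is a vertex and the other one is a vertex or lies on an edge along which its
  level varies.  Two kinds of moves are available: a tandem move along an edge of \<open>P\<close> and an edge of
  \<open>Q\<close> costs one edge of \<open>R\<close>, and while \<open>y\<close> is a vertex of \<open>Q\<close>, the component \<open>x\<close> can jump to any
  vertex of the slice of \<open>P\<close> at its level at the cost of the diameter of the stacked matrix (and
  symmetrically).

  Join the components of two vertices of \<open>R\<close> by shortest edge walks in \<open>P\<close> and in \<open>Q\<close>.  As in the
  mountain climbing problem both components have to move with equal levels.  Let \<open>m\<close> be the higher
  one of the lowest levels of the two walks.  From either end both components descend to \<open>m\<close>; such a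
  descent is built from its lower end, through the lowest of the remaining levels of the two walks.
  Jumps skip the detours, and a jump in \<open>P\<close> is only needed where at least two edges of the walk in
  \<open>P\<close> are passed.  At level \<open>m\<close> the two descents are glued by one more jump.  This gives the bound
  \<open>d(A) (d(A') + 1) + d(B) (d(B') + 1) + 1\<close>, where \<open>A'\<close> and \<open>B'\<close> are the stacked matrices; if
  \<open>d(A) = 0\<close>, the gluing jump is paid for by \<open>d(A') \<le> 1\<close>.
\<close>

section \<open>Chains of edges\<close>

definition chain :: "('a \<Rightarrow> bool) \<Rightarrow> ('a set \<Rightarrow> bool) \<Rightarrow> (nat \<Rightarrow> 'a) \<Rightarrow> nat \<Rightarrow> bool" where
  "chain V F u n \<longleftrightarrow> (\<forall>i<n. \<exists>E. F E \<and> u i \<in> E \<and> u (Suc i) \<in> E) \<and> (\<forall>i. 0 < i \<and> i < n \<longrightarrow> V (u i))"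

lemma chain_edge: "\<lbrakk>chain V F u n; i < n\<rbrakk> \<Longrightarrow> \<exists>E. F E \<and> u i \<in> E \<and> u (Suc i) \<in> E"
  unfolding chain_def by blast

lemma chain_vertex: "\<lbrakk>chain V F u n; 0 < i; i < n\<rbrakk> \<Longrightarrow> V (u i)"
  unfolding chain_def by blast

lemma chain_0 [simp]: "chain V F u 0"
  unfolding chain_def by simp

lemma chain_take: "\<lbrakk>chain V F u n; k \<le> n\<rbrakk> \<Longrightarrow> chain V F u k"
  unfolding chain_def by auto

lemma chain_drop: "chain V F u n \<Longrightarrow> chain V F (\<lambda>i. u (k + i)) (n - k)"
  unfolding chain_def by (auto simp: less_diff_conv add.commute)

lemma chain_rev:
  assumes "chain V F u n"
  shows "chain V F (\<lambda>i. u (n - i)) n"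
  unfolding chain_def
proof (intro conjI allI impI)
  fix i assume "i < n"
  then have "Suc (n - Suc i) = n - i" "n - Suc i < n" by auto
  then show "\<exists>E. F E \<and> u (n - i) \<in> E \<and> u (n - Suc i) \<in> E"
    using chain_edge[OF assms, of "n - Suc i"] by metis
next
  fix i assume "0 < i \<and> i < n"
  then show "V (u (n - i))" using chain_vertex[OF assms, of "n - i"] by auto
qed

lemma chain_update_end:
  assumes "chain V F u (Suc n)" "F E" "u n \<in> E" "q \<in> E"
  shows "chain V F (u(Suc n := q)) (Suc n)"
  using assms unfolding chain_def by (auto simp: fun_upd_def)

lemma chain_snoc:
  assumes "chain V F u n" "V (u n)" "F E" "u n \<in> E" "q \<in> E"
  shows "chain V F (u(Suc n := q)) (Suc n)"
  using assms unfolding chain_def by (auto simp: less_Suc_eq)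

lemma ex_first_minimum:
  fixes h :: "nat \<Rightarrow> 'a::linorder"
  assumes "0 < n"
  shows "\<exists>k<n. (\<forall>i<n. h k \<le> h i) \<and> (\<forall>i<k. h k < h i)"
proof -
  define m where "m = Min (h ` {..<n})"
  have m_le: "m \<le> h i" if "i < n" for i unfolding m_def using that by simp
  have "m \<in> h ` {..<n}" unfolding m_def using assms by (intro Min_in) auto
  then obtain k where "k < n" "h k = m" by auto
  then obtain j where j: "j \<le> k" "h j = m" "\<forall>i<j. h i \<noteq> m"
    using ex_least_nat_le[of "\<lambda>i. h i = m" k] by blast
  have "j < n" using j(1) \<open>k < n\<close> by simp
  moreover have "h j \<le> h i" if "i < n" for i using m_le[OF that] j(2) by simp
  moreover have "h j < h i" if "i < j" for i
    using m_le[of i] j(2,3) that \<open>j < n\<close> by (metis less_le less_trans)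
  ultimately show ?thesis by blast
qed

section \<open>Graphs with levels\<close>

locale level_graph =
  fixes vertex :: "'a \<Rightarrow> bool" and edge :: "'a set \<Rightarrow> bool" and level :: "'a \<Rightarrow> real" and diam :: nat
  assumes convex_level: "edge E \<Longrightarrow> convex (level ` E)"
    and inj_level: "\<lbrakk>edge E; \<not> level constant_on E\<rbrakk> \<Longrightarrow> inj_on level E"
    and level_not_onto: "\<lbrakk>edge E; \<not> level constant_on E\<rbrakk> \<Longrightarrow> level ` E \<noteq> UNIV"
    and nearest_vertex: "\<lbrakk>edge E; \<not> level constant_on E; t \<notin> level ` E\<rbrakk>
      \<Longrightarrow> \<exists>v\<in>E. vertex v \<and> (\<forall>r\<in>E. \<bar>level v - t\<bar> \<le> \<bar>level r - t\<bar>)"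
    and ex_chain: "\<lbrakk>vertex v; vertex w\<rbrakk> \<Longrightarrow> \<exists>n\<le>diam. \<exists>u. chain vertex edge u n \<and> u 0 = v \<and> u n = w"
begin

definition sloped :: "'a set \<Rightarrow> bool" where
  "sloped E \<longleftrightarrow> edge E \<and> \<not> level constant_on E"

definition skeletal :: "'a \<Rightarrow> bool" where
  "skeletal x \<longleftrightarrow> vertex x \<or> (\<exists>E. sloped E \<and> x \<in> E)"

lemma level_graph_uminus: "level_graph vertex edge (\<lambda>x. - level x) diam"
proof
  have neg_image: "(\<lambda>x. - level x) ` E = uminus ` level ` E" for E by auto
  have neg_constant: "(\<lambda>x. - level x) constant_on E \<longleftrightarrow> level constant_on E" for E
    unfolding constant_on_def by (metis minus_minus)
  show "convex ((\<lambda>x. - level x) ` E)" if "edge E" for E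
    unfolding neg_image by (intro convex_negations convex_level that)
  show "inj_on (\<lambda>x. - level x) E" if "edge E" "\<not> (\<lambda>x. - level x) constant_on E" for E
    using inj_level that unfolding neg_constant by (simp add: inj_on_def)
  show "(\<lambda>x. - level x) ` E \<noteq> UNIV" if "edge E" "\<not> (\<lambda>x. - level x) constant_on E" for E
    using level_not_onto[of E] that unfolding neg_constant neg_image
    by (metis inj_image_eq_iff inj_uminus surj_uminus)
  show "\<exists>v\<in>E. vertex v \<and> (\<forall>r\<in>E. \<bar>- level v - t\<bar> \<le> \<bar>- level r - t\<bar>)"
    if E: "edge E" "\<not> (\<lambda>x. - level x) constant_on E" and t: "t \<notin> (\<lambda>x. - level x) ` E" for E t
  proof -
    have "- t \<notin> level ` E" using t by force
    then obtain v where v: "v \<in> E" "vertex v" "\<forall>r\<in>E. \<bar>level v - - t\<bar> \<le> \<bar>level r - - t\<bar>"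
      using nearest_vertex[of E "- t"] E unfolding neg_constant by blast
    have "\<bar>- level r - t\<bar> = \<bar>level r - - t\<bar>" for r by linarith
    then show ?thesis using v by auto
  qed
qed (rule ex_chain)

lemma sloped_uminus: "level_graph.sloped edge (\<lambda>x. - level x) = sloped"
  and skeletal_uminus: "level_graph.skeletal vertex edge (\<lambda>x. - level x) = skeletal"
proof -
  interpret neg: level_graph vertex edge "\<lambda>x. - level x" diam by (rule level_graph_uminus)
  show "neg.sloped = sloped"
    unfolding neg.sloped_def sloped_def constant_on_def fun_eq_iff by (metis minus_minus)
  then show "neg.skeletal = skeletal" unfolding neg.skeletal_def skeletal_def by simp
qed

lemma slopedI: "\<lbrakk>edge E; p \<in> E; q \<in> E; level p \<noteq> level q\<rbrakk> \<Longrightarrow> sloped E"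
  unfolding sloped_def constant_on_def by metis

lemma sloped_edge: "sloped E \<Longrightarrow> edge E"
  unfolding sloped_def by simp

lemma sloped_inj: "\<lbrakk>sloped E; p \<in> E; q \<in> E; level p = level q\<rbrakk> \<Longrightarrow> p = q"
  using inj_onD[OF inj_level] unfolding sloped_def by metis

lemma edge_between:
  assumes "edge E" "p \<in> E" "q \<in> E" "t \<in> closed_segment (level p) (level q)"
  shows "t \<in> level ` E"
proof -
  have "closed_segment (level p) (level q) \<subseteq> level ` E"
    using assms(2,3) by (intro closed_segment_subset convex_level assms(1)) auto
  then show ?thesis using assms(4) by blast
qed

lemma sloped_vertex:
  assumes "sloped E"
  obtains w where "w \<in> E" "vertex w"
proof -
  obtain t where "t \<notin> level ` E" using level_not_onto assms unfolding sloped_def by blast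
  then show thesis using nearest_vertex assms that unfolding sloped_def by metis
qed

lemma top_vertex:
  assumes "sloped E" "p \<in> E" "level p < t" "t \<notin> level ` E"
  obtains v where "v \<in> E" "vertex v" "level v < t" "\<And>r. r \<in> E \<Longrightarrow> level r \<le> level v"
proof -
  have below: "level r < t" if "r \<in> E" for r
  proof (rule ccontr)
    assume "\<not> level r < t"
    then have "t \<in> closed_segment (level p) (level r)"
      using assms(3) by (simp add: closed_segment_eq_real_ivl)
    then show False
      using edge_between[OF sloped_edge[OF assms(1)] assms(2) that] assms(4) by blast
  qed
  obtain v where v: "v \<in> E" "vertex v" "\<forall>r\<in>E. \<bar>level v - t\<bar> \<le> \<bar>level r - t\<bar>"
    using nearest_vertex assms(1,4) unfolding sloped_def by blast
  have top: "level r \<le> level v" if "r \<in> E" for r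
    using v(3)[rule_format, OF that] below[OF that] by linarith
  show thesis by (rule that[OF v(1,2) below[OF v(1)] top])
qed

lemma chain_end_skeletal:
  assumes "chain vertex edge u n" "skeletal (u 0)" "\<And>i. i < n \<Longrightarrow> level (u i) \<noteq> level (u n)"
  shows "skeletal (u n)"
proof (cases n)
  case (Suc k)
  obtain E where "edge E" "u k \<in> E" "u n \<in> E" using chain_edge[OF assms(1), of k] Suc by auto
  then show ?thesis using slopedI assms(3)[of k] Suc unfolding skeletal_def by blast
qed (use assms(2) in simp)

lemma first_passage:
  assumes u: "chain vertex edge u n" and k: "k \<le> n"
    and t: "t \<in> closed_segment (level (u 0)) (level (u k))"
  obtains K p where "K \<le> k" "chain vertex edge p K" "p 0 = u 0" "level (p K) = t"
    "\<forall>i<K. p i = u i \<and> t \<notin> closed_segment (level (u 0)) (level (u i))"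
    "level (u K) = t \<longrightarrow> p K = u K"
proof -
  obtain K where K: "K \<le> k" "t \<in> closed_segment (level (u 0)) (level (u K))"
    and before: "\<And>i. i < K \<Longrightarrow> t \<notin> closed_segment (level (u 0)) (level (u i))"
    using ex_least_nat_le[of "\<lambda>i. t \<in> closed_segment (level (u 0)) (level (u i))", OF t] by auto
  show thesis
  proof (cases K)
    case 0
    then show thesis using that[of 0 u] K by simp
  next
    case (Suc i)
    obtain E where E: "edge E" "u i \<in> E" "u K \<in> E" using chain_edge[OF u, of i] Suc K(1) k by auto
    have "t \<in> closed_segment (level (u i)) (level (u K))"
      using before[of i] K(2) Suc by (auto simp: closed_segment_eq_real_ivl split: if_splits)
    then have "t \<in> level ` E" by (rule edge_between[OF E])
    then obtain q where q: "q \<in> E" "level q = t" "level (u K) = t \<longrightarrow> q = u K"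
      using E(3) by blast
    have "chain vertex edge (u(K := q)) K"
      using chain_update_end[of vertex edge u i E q] E q(1) chain_take[OF u, of K] K(1) k Suc
      by simp
    then show thesis using that[of K "u(K := q)"] K(1) before q Suc by auto
  qed
qed

definition descends :: "(nat \<Rightarrow> 'a) \<Rightarrow> nat \<Rightarrow> bool" where
  "descends u n \<longleftrightarrow> chain vertex edge u n \<and> (\<forall>i<n. level (u n) < level (u i))
    \<and> (\<not> vertex (u 0) \<and> 0 < n \<longrightarrow> level (u 1) < level (u 0))"

lemma descends_0 [simp]: "descends u 0"
  unfolding descends_def by simp

lemma descends_le: "\<lbrakk>descends u n; i \<le> n\<rbrakk> \<Longrightarrow> level (u n) \<le> level (u i)"
  unfolding descends_def by (metis less_imp_le nat_less_le order_refl)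

lemma descends_end_skeletal: "\<lbrakk>descends u n; skeletal (u 0)\<rbrakk> \<Longrightarrow> skeletal (u n)"
  unfolding descends_def by (metis chain_end_skeletal less_irrefl)

lemma descends_take:
  assumes "descends u n" "k \<le> n" "\<And>i. i < k \<Longrightarrow> level (u k) < level (u i)"
  shows "descends u k"
  using assms chain_take[of vertex edge u n k] unfolding descends_def by auto

lemma descends_last_edge:
  assumes "descends u (Suc n)"
  obtains E where "sloped E" "u n \<in> E" "u (Suc n) \<in> E"
proof -
  obtain E where "edge E" "u n \<in> E" "u (Suc n) \<in> E"
    using assms chain_edge[of vertex edge u "Suc n" n] unfolding descends_def by auto
  then show thesis using that slopedI[of E "u n" "u (Suc n)"] assms unfolding descends_def by force
qed

lemma descends_cut:
  assumes u: "descends u (Suc n)" and E: "edge E" "u n \<in> E" "q \<in> E"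
    and low: "\<And>i. i \<le> n \<Longrightarrow> level q \<le> level (u i)"
  obtains i w where "i \<le> Suc n" "descends w i" "w 0 = u 0" "level (w i) = level q"
    "w i = (if i = Suc n then q else u i)" "\<not> vertex (u 0) \<Longrightarrow> i = 0 \<Longrightarrow> n = 0"
proof -
  define w where "w = u(Suc n := q)"
  have "level (w (Suc n)) = level q" unfolding w_def by simp
  then obtain i where i: "i \<le> Suc n" "level (w i) = level q"
    and before: "\<forall>h<i. level (w h) \<noteq> level q"
    using ex_least_nat_le[of "\<lambda>i. level (w i) = level q"] by blast
  have above: "level q < level (w h)" if "h < i" for h
    using low[of h] before[rule_format, OF that] i(1) that unfolding w_def by simp
  have steep: "level (u 1) < level (u 0)" if "\<not> vertex (u 0)"
    using u that unfolding descends_def by simp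
  have "chain vertex edge w i"
    using chain_take[OF chain_update_end[of vertex edge u n E q] i(1)] u E
    unfolding w_def descends_def by simp
  moreover have "level (w 1) < level (w 0)" if "\<not> vertex (w 0)" "0 < i"
    using steep above[OF that(2)] that(1) unfolding w_def by (cases n) auto
  ultimately have "descends w i" using above i(2) unfolding descends_def by simp
  moreover have "n = 0" if "\<not> vertex (u 0)" "i = 0"
    using steep[OF that(1)] low[of 1] i(2) that(2) unfolding w_def by (cases n) auto
  ultimately show thesis using that[of i w] i unfolding w_def by simp
qed

lemma first_descent:
  assumes u: "chain vertex edge u n" and steep: "\<not> vertex (u 0) \<Longrightarrow> 0 < n \<Longrightarrow> level (u 1) < level (u 0)"
    and k: "k \<le> n" and m: "level (u k) \<le> m" "m \<le> level (u 0)"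
  obtains K p where "K \<le> k" "descends p K" "p 0 = u 0" "level (p K) = m"
    "level (u K) = m \<longrightarrow> p K = u K"
proof -
  have "m \<in> closed_segment (level (u 0)) (level (u k))"
    using m by (auto simp: closed_segment_eq_real_ivl)
  then obtain K p where p: "K \<le> k" "chain vertex edge p K" "p 0 = u 0" "level (p K) = m"
    "\<forall>i<K. p i = u i \<and> m \<notin> closed_segment (level (u 0)) (level (u i))"
    "level (u K) = m \<longrightarrow> p K = u K"
    using first_passage[OF u k] by blast
  have above: "m < level (p i)" if "i < K" for i
    using p(5) that m(2) by (auto simp: closed_segment_eq_real_ivl split: if_splits)
  moreover have "level (p 1) < level (p 0)" if "\<not> vertex (p 0)" "0 < K"
  proof (cases "K = 1")
    case True
    then show ?thesis using above[of 0] p(4) by simp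
  next
    case False
    then show ?thesis using steep p(1,3,5) k that by simp
  qed
  ultimately show thesis using that[of K p] p unfolding descends_def by simp
qed

definition low :: "'a \<Rightarrow> bool" where
  "low x \<longleftrightarrow> vertex x \<or> (\<exists>E w. edge E \<and> x \<in> E \<and> w \<in> E \<and> vertex w \<and> level w < level x)"

lemma not_low_ray:
  assumes x: "skeletal x" "\<not> low x" and m: "m \<le> level x"
  obtains E w q where "sloped E" "x \<in> E" "w \<in> E" "vertex w" "q \<in> E" "level q = m"
proof -
  have nv: "\<not> vertex x" using x(2) unfolding low_def by simp
  then obtain E where E: "sloped E" "x \<in> E" using x(1) unfolding skeletal_def by blast
  obtain w where w: "w \<in> E" "vertex w" using sloped_vertex[OF E(1)] by blast
  have "m \<in> level ` E"
  proof (rule ccontr)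
    assume m_notin: "m \<notin> level ` E"
    then have "m < level x" using m E(2) by (metis image_eqI order_le_less)
    obtain v where v: "v \<in> E" "vertex v" "\<forall>r\<in>E. \<bar>level v - m\<bar> \<le> \<bar>level r - m\<bar>"
      using nearest_vertex m_notin E(1) unfolding sloped_def by blast
    have "level v \<le> level x" using v(3)[rule_format, OF E(2)] \<open>m < level x\<close> by linarith
    moreover have "level v \<noteq> level x" using sloped_inj[OF E(1) v(1) E(2)] v(2) nv by blast
    ultimately show False using x(2) v sloped_edge[OF E(1)] E(2) unfolding low_def by force
  qed
  then show thesis using that E w by blast
qed

lemma low_or_low_uminus:
  assumes "skeletal x"
  shows "low x \<or> level_graph.low vertex edge (\<lambda>x. - level x) x"
proof (rule disjCI)
  interpret neg: level_graph vertex edge "\<lambda>x. - level x" diam by (rule level_graph_uminus)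
  assume x: "\<not> neg.low x"
  then have nv: "\<not> vertex x" unfolding neg.low_def by simp
  then obtain E where E: "sloped E" "x \<in> E" using assms unfolding skeletal_def by blast
  obtain w where w: "w \<in> E" "vertex w" using sloped_vertex[OF E(1)] by blast
  have "level w \<noteq> level x" using sloped_inj[OF E(1) w(1) E(2)] w(2) nv by blast
  then show "low x" using x E w sloped_edge[OF E(1)] unfolding low_def neg.low_def by force
qed

definition low_route :: "(nat \<Rightarrow> 'a) \<Rightarrow> nat \<Rightarrow> bool" where
  "low_route u n \<longleftrightarrow> chain vertex edge u n
    \<and> n \<le> diam + of_bool (\<not> vertex (u 0)) + of_bool (\<not> vertex (u n))
    \<and> (\<not> vertex (u 0) \<longrightarrow> 0 < n \<and> level (u 1) < level (u 0))
    \<and> (\<not> vertex (u n) \<longrightarrow> 0 < n \<and> level (u (n - 1)) < level (u n))"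

lemma low_route_chain: "low_route u n \<Longrightarrow> chain vertex edge u n"
  unfolding low_route_def by blast

lemma low_route_rev: "low_route u n \<Longrightarrow> low_route (\<lambda>i. u (n - i)) n"
  unfolding low_route_def using chain_rev[of vertex edge u n] by auto

lemma low_route_snoc:
  assumes u: "low_route u n" "vertex (u n)"
    and x: "edge E" "u n \<in> E" "x \<in> E" "level (u n) < level x" "\<not> vertex x"
  shows "low_route (u(Suc n := x)) (Suc n)"
  using u x chain_snoc[OF low_route_chain[OF u(1)] u(2) x(1-3)] unfolding low_route_def by auto

lemma low_route_to_low:
  assumes "low x" and to_vertex: "\<And>w. vertex w \<Longrightarrow> \<exists>u n. low_route u n \<and> u 0 = z \<and> u n = w"
  shows "\<exists>u n. low_route u n \<and> u 0 = z \<and> u n = x"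
proof (cases "vertex x")
  case False
  then obtain E w where w: "edge E" "x \<in> E" "w \<in> E" "vertex w" "level w < level x"
    using assms(1) unfolding low_def by blast
  obtain u n where u: "low_route u n" "u 0 = z" "u n = w" using to_vertex[OF w(4)] by blast
  then have "low_route (u(Suc n := x)) (Suc n)" using low_route_snoc w False by simp
  then show ?thesis using u(2) by (intro exI[of _ "u(Suc n := x)"] exI[of _ "Suc n"]) simp
qed (rule to_vertex)

lemma ex_low_route:
  assumes "low x" "low x'"
  obtains u n where "low_route u n" "u 0 = x" "u n = x'"
proof -
  let ?joined = "\<lambda>a b. \<exists>u n. low_route u n \<and> u 0 = a \<and> u n = b"
  have sym: "?joined b a" if "?joined a b" for a b
    using that low_route_rev by (metis diff_self_eq_0 diff_zero)
  have vertices: "?joined v w" if vw: "vertex v" "vertex w" for v w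
  proof -
    obtain n u where "n \<le> diam" "chain vertex edge u n" "u 0 = v" "u n = w"
      using ex_chain[OF vw] by blast
    then show ?thesis using vw unfolding low_route_def by (intro exI[of _ u] exI[of _ n]) simp
  qed
  have "?joined v x" if "vertex v" for v
    by (rule low_route_to_low[OF assms(1) vertices[OF that]])
  then have "?joined x x'" by (rule low_route_to_low[OF assms(2) sym])
  then obtain u n where "low_route u n" "u 0 = x" "u n = x'" by blast
  then show thesis by (rule that)
qed

lemma low_route_minimum:
  assumes u: "low_route u n"
  obtains i where "i \<le> n" "\<forall>h\<le>n. level (u i) \<le> level (u h)" "vertex (u i)" "descends u i"
proof -
  obtain i where i: "i \<le> n" "\<forall>h\<le>n. level (u i) \<le> level (u h)" "\<forall>h<i. level (u i) < level (u h)"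
    using ex_first_minimum[of "Suc n" "\<lambda>h. level (u h)"] by (auto simp: less_Suc_eq_le)
  have "vertex (u i)"
  proof (rule ccontr)
    assume nv: "\<not> vertex (u i)"
    consider (first) "i = 0" | (last) "i = n" | (interior) "0 < i" "i < n" using i(1) by linarith
    then show False
    proof cases
      case first
      then show False using u nv i(2)[rule_format, of 1] unfolding low_route_def by force
    next
      case last
      then show False using u nv i(2)[rule_format, of "n - 1"] unfolding low_route_def by force
    next
      case interior
      then show False using chain_vertex[OF low_route_chain[OF u]] nv by blast
    qed
  qed
  moreover have "descends u i"
    using u i(3) chain_take[OF _ i(1)] unfolding descends_def low_route_def by blast
  ultimately show thesis using that i(1,2) by blast
qed

lemma low_route_first_last_minimum:
  assumes u: "low_route u n"
  obtains i l where "i + l \<le> n" "\<forall>h\<le>n. level (u i) \<le> level (u h)" "level (u (n - l)) = level (u i)"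
    "vertex (u i)" "vertex (u (n - l))" "descends u i" "descends (\<lambda>h. u (n - h)) l"
proof -
  obtain i where i: "i \<le> n" "\<forall>h\<le>n. level (u i) \<le> level (u h)" "vertex (u i)" "descends u i"
    by (rule low_route_minimum[OF u])
  obtain l where l: "l \<le> n" "\<forall>h\<le>n. level (u (n - l)) \<le> level (u (n - h))" "vertex (u (n - l))"
    "descends (\<lambda>h. u (n - h)) l"
    by (rule low_route_minimum[OF low_route_rev[OF u]])
  have levels: "level (u (n - l)) = level (u i)"
    using i(1) i(2)[rule_format, of "n - l"] l(2)[rule_format, of "n - i"] by simp
  have "i + l \<le> n"
  proof (rule ccontr)
    assume "\<not> i + l \<le> n"
    then have "level (u i) < level (u (n - l))" using i(4) l(1) unfolding descends_def by simp
    then show False using levels by simp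
  qed
  then show thesis using that i(2-4) l(3,4) levels by blast
qed

lemma descends_along_edge:
  assumes "sloped E" "x \<in> E" "q \<in> E" "level q \<le> level x"
  obtains K p where "K \<le> 1" "descends p K" "p 0 = x" "p K = q"
proof (cases "level q = level x")
  case True
  then have "x = q" using sloped_inj[OF assms(1-3)] by simp
  then show thesis by (intro that[of 0 "\<lambda>_. x"]) simp_all
next
  case False
  have "chain vertex edge (case_nat x (\<lambda>_. q)) 1"
    using sloped_edge[OF assms(1)] assms(2,3) unfolding chain_def by auto
  then have "descends (case_nat x (\<lambda>_. q)) 1"
    using assms(4) False unfolding descends_def by simp
  then show thesis by (rule that[OF order_refl]) simp_all
qed

end

section \<open>Climbing with equal levels\<close>

lemma jump_count_add_le:
  fixes i n e D :: nat
  assumes "i \<le> n" "e \<le> 1" "i = 0 \<Longrightarrow> e = 0 \<or> n = 1"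
  shows "(i - e - 1) * D + of_bool (i + 2 \<le> n) * D \<le> (n - e - 1) * D"
proof -
  have "i - e - 1 + of_bool (i + 2 \<le> n) \<le> n - e - 1" using assms by (cases "i = 0") auto
  then show ?thesis unfolding add_mult_distrib[symmetric] by (rule mult_right_mono) simp
qed

lemma valley_jumps_le:
  fixes \<kappa> \<kappa>' d D :: nat
  assumes few: "\<kappa> + \<kappa>' \<le> d + of_bool z" and D: "d = 0 \<Longrightarrow> D \<le> 1"
  shows "\<kappa> + \<kappa>' + (\<kappa> - 1 + of_bool (\<not> z) + (\<kappa>' - 1)) * D \<le> d * (D + 1) + 1"
proof (cases "z \<or> 0 < d")
  case True
  then have "\<kappa> - 1 + of_bool (\<not> z) + (\<kappa>' - 1) \<le> d" using few by (cases "\<kappa> = 0"; cases z) auto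
  then have "(\<kappa> - 1 + of_bool (\<not> z) + (\<kappa>' - 1)) * D \<le> d * D" by (rule mult_right_mono) simp
  moreover have "\<kappa> + \<kappa>' \<le> d + 1" using few by (cases z) auto
  ultimately show ?thesis unfolding distrib_left by linarith
next
  case False
  then show ?thesis using few D by simp
qed

lemma valley_cost_le:
  fixes K K' i l L d d' D D' e e' h h' :: nat
  assumes few: "K - e + (K' - e') \<le> d + of_bool z" and D: "d = 0 \<Longrightarrow> D \<le> 1"
    and L: "L \<le> d' + h + h'" "i + l \<le> L" "h \<le> i" "h' \<le> l"
    and zero: "K = 0 \<Longrightarrow> i = 0" "K' = 0 \<Longrightarrow> l = 0" and ends: "e + h \<le> 1" "e' + h' \<le> 1"
  shows "K + i - 1 + (K - e - 1) * D + (i - h - 1) * D' + of_bool (\<not> z) * D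
      + (L - l - i + of_bool (i \<noteq> L - l) * D')
      + (K' + l - 1 + (K' - e' - 1) * D + (l - h' - 1) * D')
    \<le> d * (D + 1) + d' * (D' + 1) + 1"
proof -
  have "K + i - 1 + h \<le> K - e + i" using zero(1) ends(1) L(3) by (cases "K = 0") auto
  moreover have "K' + l - 1 + h' \<le> K' - e' + l" using zero(2) ends(2) L(4) by (cases "K' = 0") auto
  ultimately have edges: "K + i - 1 + (L - l - i) + (K' + l - 1) \<le> K - e + (K' - e') + d'"
    using L by linarith
  have "i - h - 1 + of_bool (i \<noteq> L - l) + (l - h' - 1) \<le> d'"
    using L by (cases "i = L - l") auto
  then have jumps: "(i - h - 1 + of_bool (i \<noteq> L - l) + (l - h' - 1)) * D' \<le> d' * D'"
    by (rule mult_right_mono) simp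
  show ?thesis
    using add_mono[OF add_mono[OF edges jumps] valley_jumps_le[OF few D]]
    by (simp add: algebra_simps)
qed

locale level_graph_pair =
  A: level_graph V E f d + B: level_graph V' E' g d'
  for V :: "'a \<Rightarrow> bool" and E f d and V' :: "'b \<Rightarrow> bool" and E' g d'
begin

definition joint_vertex :: "'a \<Rightarrow> 'b \<Rightarrow> bool" where
  "joint_vertex x y \<longleftrightarrow> f x = g y \<and> A.skeletal x \<and> B.skeletal y \<and> (V x \<or> V' y)"

lemma joint_vertex_level: "joint_vertex x y \<Longrightarrow> f x = g y"
  unfolding joint_vertex_def by simp

lemma level_graph_pair_swap: "level_graph_pair V' E' g d' V E f d" ..

lemma joint_vertex_swap: "level_graph_pair.joint_vertex V' E' g V E f y x \<longleftrightarrow> joint_vertex x y"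
  unfolding joint_vertex_def level_graph_pair.joint_vertex_def[OF level_graph_pair_swap] by auto

lemma level_graph_pair_uminus: "level_graph_pair V E (\<lambda>x. - f x) d V' E' (\<lambda>y. - g y) d'"
  by (intro level_graph_pair.intro A.level_graph_uminus B.level_graph_uminus)

lemma joint_vertex_uminus:
  "level_graph_pair.joint_vertex V E (\<lambda>x. - f x) V' E' (\<lambda>y. - g y) = joint_vertex"
  unfolding level_graph_pair.joint_vertex_def[OF level_graph_pair_uminus] joint_vertex_def
    A.skeletal_uminus B.skeletal_uminus by simp

end

locale climbing = level_graph_pair V E f d V' E' g d'
  for V :: "'a \<Rightarrow> bool" and E f d and V' :: "'b \<Rightarrow> bool" and E' g d' +
  fixes \<delta> :: "'a \<times> 'b \<Rightarrow> 'a \<times> 'b \<Rightarrow> enat" and D D' :: nat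
  assumes dist_self: "\<delta> s s = 0"
    and dist_commute: "\<delta> s t = \<delta> t s"
    and dist_triangle: "\<delta> s u \<le> \<delta> s t + \<delta> t u"
    and dist_tandem: "\<lbrakk>joint_vertex x y; joint_vertex x' y'; E F; x \<in> F; x' \<in> F;
        E' G; y \<in> G; y' \<in> G; A.sloped F \<or> B.sloped G\<rbrakk> \<Longrightarrow> \<delta> (x, y) (x', y') \<le> 1"
    and dist_jumpA: "\<lbrakk>V' y; joint_vertex x y; joint_vertex x' y\<rbrakk> \<Longrightarrow> \<delta> (x, y) (x', y) \<le> D"
    and dist_jumpB: "\<lbrakk>V x; joint_vertex x y; joint_vertex x y'\<rbrakk> \<Longrightarrow> \<delta> (x, y) (x, y') \<le> D'"
    and D_le_1: "d = 0 \<Longrightarrow> D \<le> 1" and D'_le_1: "d' = 0 \<Longrightarrow> D' \<le> 1"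
begin

definition conn :: "'a \<Rightarrow> 'b \<Rightarrow> 'a \<Rightarrow> 'b \<Rightarrow> nat \<Rightarrow> bool" where
  "conn x y x' y' n \<longleftrightarrow> \<delta> (x, y) (x', y') \<le> n"

lemma conn_refl: "conn x y x y n"
  unfolding conn_def dist_self by simp

lemma conn_sym: "conn x y x' y' n \<Longrightarrow> conn x' y' x y n"
  unfolding conn_def by (simp add: dist_commute)

lemma conn_mono: "\<lbrakk>conn x y x' y' m; m \<le> n\<rbrakk> \<Longrightarrow> conn x y x' y' n"
  unfolding conn_def by (meson enat_ord_simps(1) order_trans)

lemma conn_trans: "\<lbrakk>conn x y x' y' m; conn x' y' x'' y'' n\<rbrakk> \<Longrightarrow> conn x y x'' y'' (m + n)"
  unfolding conn_def plus_enat_simps(1)[symmetric] by (meson add_mono dist_triangle order_trans)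

lemma conn_tandem:
  "\<lbrakk>joint_vertex x y; joint_vertex x' y'; E F; x \<in> F; x' \<in> F; E' G; y \<in> G; y' \<in> G;
    A.sloped F \<or> B.sloped G\<rbrakk> \<Longrightarrow> conn x y x' y' 1"
  unfolding conn_def one_enat_def[symmetric] by (rule dist_tandem)

lemma conn_jumpA: "\<lbrakk>V' y; joint_vertex x y; joint_vertex x' y\<rbrakk> \<Longrightarrow> conn x y x' y D"
  unfolding conn_def by (rule dist_jumpA)

lemma conn_jumpB: "\<lbrakk>V x; joint_vertex x y; joint_vertex x y'\<rbrakk> \<Longrightarrow> conn x y x y' D'"
  unfolding conn_def by (rule dist_jumpB)

abbreviation swap_dist :: "'b \<times> 'a \<Rightarrow> 'b \<times> 'a \<Rightarrow> enat" where
  "swap_dist s t \<equiv> \<delta> (prod.swap s) (prod.swap t)"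

lemma climbing_swap: "climbing V' E' g d' V E f d swap_dist D' D"
proof -
  interpret sw: level_graph_pair V' E' g d' V E f d by (rule level_graph_pair_swap)
  show ?thesis
  proof
    show "swap_dist (y, x) (y', x') \<le> 1"
      if "sw.joint_vertex y x" "sw.joint_vertex y' x'" "E' G" "y \<in> G" "y' \<in> G"
        "E F" "x \<in> F" "x' \<in> F" "B.sloped G \<or> A.sloped F" for x y x' y' F G
      using dist_tandem[of x y x' y' F G] that by (auto simp: joint_vertex_swap)
  qed (use dist_self dist_commute dist_triangle dist_jumpA dist_jumpB D_le_1 D'_le_1 in
      \<open>auto simp: joint_vertex_swap\<close>)
qed

lemma conn_swap: "climbing.conn swap_dist y x y' x' n \<longleftrightarrow> conn x y x' y' n"
  unfolding conn_def climbing.conn_def[OF climbing_swap] by simp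

lemma climbing_uminus: "climbing V E (\<lambda>x. - f x) d V' E' (\<lambda>y. - g y) d' \<delta> D D'"
proof -
  interpret neg: level_graph_pair V E "\<lambda>x. - f x" d V' E' "\<lambda>y. - g y" d'
    by (rule level_graph_pair_uminus)
  show ?thesis
    by unfold_locales
      (use dist_self dist_commute dist_triangle dist_tandem dist_jumpA dist_jumpB D_le_1 D'_le_1 in
        \<open>auto simp: joint_vertex_uminus A.sloped_uminus B.sloped_uminus\<close>)
qed

lemma conn_follow_within:
  assumes "B.sloped G" "chain V E u n" "\<And>i. i \<le> n \<Longrightarrow> f (u i) \<in> g ` G"
    and "y \<in> G" "y' \<in> G" "joint_vertex (u 0) y" "joint_vertex (u n) y'"
  shows "conn (u 0) y (u n) y' n"
  using assms(2-7)
proof (induction n arbitrary: y')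
  case 0
  then have "y = y'" using B.sloped_inj[OF assms(1)] joint_vertex_level by metis
  then show ?case using conn_refl by simp
next
  case (Suc n)
  obtain F where F: "E F" "u n \<in> F" "u (Suc n) \<in> F"
    using chain_edge[OF Suc.prems(1), of n] by blast
  show ?case
  proof (cases "n = 0")
    case True
    then show ?thesis
      using conn_tandem[OF Suc.prems(5,6), of F G] F Suc.prems(3,4) assms(1) B.sloped_edge by auto
  next
    case False
    then have V: "V (u n)" using chain_vertex[OF Suc.prems(1)] by simp
    obtain z where z: "z \<in> G" "f (u n) = g z" using Suc.prems(2)[of n] by auto
    have joint_z: "joint_vertex (u n) z"
      using V z assms(1) unfolding joint_vertex_def A.skeletal_def B.skeletal_def by blast
    have "conn (u 0) y (u n) z n"
      using Suc.IH[of z] chain_take[OF Suc.prems(1), of n] Suc.prems(2,3,5) z(1) joint_z by auto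
    moreover have "conn (u n) z (u (Suc n)) y' 1"
      using conn_tandem[OF joint_z Suc.prems(6) F] B.sloped_edge z(1) Suc.prems(4) assms(1) by blast
    ultimately show ?thesis using conn_trans by fastforce
  qed
qed

lemma conn_follow_to_top:
  assumes G: "B.sloped G" and v: "v \<in> G" "V' v" "\<And>r. r \<in> G \<Longrightarrow> g r \<le> g v"
    and u: "chain V E u n" "\<And>i. i \<le> n \<Longrightarrow> \<exists>r\<in>G. g r \<le> f (u i)" and k: "k \<le> n" "g v \<le> f (u k)"
    and y: "y \<in> G" "joint_vertex (u 0) y"
  obtains i p where "i \<le> k" "joint_vertex p v" "conn (u 0) y p v i"
proof -
  have "g v \<in> closed_segment (f (u 0)) (f (u k))"
    using v(3)[OF y(1)] joint_vertex_level[OF y(2)] k(2) by (simp add: closed_segment_eq_real_ivl)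
  then obtain K p where p: "K \<le> k" "chain V E p K" "p 0 = u 0" "f (p K) = g v"
    "\<forall>i<K. p i = u i \<and> g v \<notin> closed_segment (f (u 0)) (f (u i))"
    by (rule A.first_passage[OF u(1) k(1)]) blast
  have below: "f (p i) < g v" if "i < K" for i
    using p(5) that v(3)[OF y(1)] joint_vertex_level[OF y(2)]
    by (auto simp: closed_segment_eq_real_ivl split: if_splits)
  have "A.skeletal (p K)"
    by (rule A.chain_end_skeletal[OF p(2)])
      (use y(2) p(3,4) below in \<open>force simp: joint_vertex_def\<close>)+
  then have joint_top: "joint_vertex (p K) v"
    using p(4) v(2) unfolding joint_vertex_def B.skeletal_def by blast
  have levels: "f (p i) \<in> g ` G" if "i \<le> K" for i
  proof (cases "i = K")
    case True
    then show ?thesis using p(4) v(1) by simp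
  next
    case False
    then have i: "i < K" using that by simp
    obtain r where r: "r \<in> G" "g r \<le> f (p i)" using u(2)[of i] p(1,5) i k(1) by force
    then have "f (p i) \<in> closed_segment (g r) (g v)"
      using below[OF i] by (simp add: closed_segment_eq_real_ivl)
    then show ?thesis by (rule B.edge_between[OF B.sloped_edge[OF G] r(1) v(1)])
  qed
  have "conn (u 0) y (p K) v K"
    using conn_follow_within[OF G p(2) levels y(1) v(1)] y(2) joint_top p(3) by simp
  then show thesis using that[OF p(1) joint_top] by blast
qed

text \<open>If the chain rises above the edge \<open>G\<close>, the part above \<open>G\<close> is skipped by a jump made while the
  second component waits at the upper end of \<open>G\<close>.\<close>

lemma conn_follow:
  assumes G: "B.sloped G" and u: "chain V E u n" and low: "\<And>i. i \<le> n \<Longrightarrow> \<exists>r\<in>G. g r \<le> f (u i)"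
    and y: "y \<in> G" "y' \<in> G" "joint_vertex (u 0) y" "joint_vertex (u n) y'"
  shows "conn (u 0) y (u n) y' (n + of_bool (2 \<le> n) * D)"
proof (cases "\<forall>i\<le>n. f (u i) \<in> g ` G")
  case True
  then have "conn (u 0) y (u n) y' n" using conn_follow_within[OF G u _ y] by blast
  then show ?thesis by (rule conn_mono) simp
next
  case False
  then obtain k where k: "k \<le> n" "f (u k) \<notin> g ` G" by blast
  have "f (u 0) \<in> g ` G" "f (u n) \<in> g ` G" using y joint_vertex_level by auto
  then have "k \<noteq> 0" "k \<noteq> n" using k(2) by metis+
  obtain r where "r \<in> G" "g r < f (u k)" using low[OF k(1)] k(2) by (metis image_eqI order_le_less)
  then obtain v where v: "v \<in> G" "V' v" "\<And>r. r \<in> G \<Longrightarrow> g r \<le> g v" "g v < f (u k)"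
    using B.top_vertex[OF G _ _ k(2)] by metis
  obtain i p where p: "i \<le> k" "joint_vertex p v" "conn (u 0) y p v i"
    by (rule conn_follow_to_top[OF G v(1-3) u low k(1) less_imp_le[OF v(4)] y(1,3)])
  obtain j q where q: "j \<le> n - k" "joint_vertex q v" "conn (u n) y' q v j"
    by (rule conn_follow_to_top[OF G v(1-3) chain_rev[OF u], of "n - k" y'])
      (use low v(4) k(1) y(2,4) in auto)
  have "conn (u 0) y (u n) y' (i + D + j)"
    by (rule conn_trans[OF conn_trans[OF p(3) conn_jumpA[OF v(2) p(2) q(2)]] conn_sym[OF q(3)]])
  then show ?thesis
    by (rule conn_mono) (use p(1) q(1) k(1) \<open>k \<noteq> 0\<close> \<open>k \<noteq> n\<close> in auto)
qed

definition descent_cost :: "'a \<Rightarrow> nat \<Rightarrow> 'b \<Rightarrow> nat \<Rightarrow> nat" where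
  "descent_cost x K y L =
    K + L - 1 + (K - of_bool (\<not> V x) - 1) * D + (L - of_bool (\<not> V' y) - 1) * D'"

lemma descent_cost_swap: "climbing.descent_cost V' V D' D y L x K = descent_cost x K y L"
  unfolding descent_cost_def climbing.descent_cost_def[OF climbing_swap]
  by (simp add: add.commute add.left_commute)

lemma descent_cost_add_le:
  assumes "j < K" "j = 0 \<Longrightarrow> V x" and "i \<le> Suc L" "i = 0 \<Longrightarrow> V' y \<or> L = 0"
  shows "descent_cost x j y i + of_bool (i < L) * D' + (K - j + of_bool (j + 2 \<le> K) * D)
    \<le> descent_cost x K y (Suc L)"
proof -
  have edges: "j + i - 1 + (K - j) \<le> K + Suc L - 1" using assms(1,3) by simp
  have jumpsA: "(j - of_bool (\<not> V x) - 1) * D + of_bool (j + 2 \<le> K) * D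
      \<le> (K - of_bool (\<not> V x) - 1) * D"
    by (rule jump_count_add_le) (use assms(1,2) in auto)
  have jumpsB: "(i - of_bool (\<not> V' y) - 1) * D' + of_bool (i + 2 \<le> Suc L) * D'
      \<le> (Suc L - of_bool (\<not> V' y) - 1) * D'"
    by (rule jump_count_add_le) (use assms(3,4) in auto)
  have "i + 2 \<le> Suc L \<longleftrightarrow> i < L" by auto
  then show ?thesis
    using add_mono[OF add_mono[OF edges jumpsA] jumpsB] by (simp only: descent_cost_def ac_simps)
qed

lemma conn_follow_descent:
  assumes G: "B.sloped G" "q \<in> G" "y \<in> G" and u: "A.descends u K" "j \<le> K"
    and joint: "joint_vertex (u j) q" "joint_vertex (u K) y"
  shows "conn (u j) q (u K) y (K - j + of_bool (j + 2 \<le> K) * D)"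
proof -
  have "conn (u (j + 0)) q (u (j + (K - j))) y (K - j + of_bool (2 \<le> K - j) * D)"
  proof (rule conn_follow[OF G(1) _ _ G(2,3)])
    show "chain V E (\<lambda>h. u (j + h)) (K - j)" using u(1) chain_drop unfolding A.descends_def by blast
    show "\<exists>r\<in>G. g r \<le> f (u (j + h))" if "h \<le> K - j" for h
      using G(3) A.descends_le[OF u(1), of "j + h"] joint_vertex_level[OF joint(2)] that u(2)
      by (intro bexI[of _ y]) simp_all
  qed (use joint u(2) in simp_all)
  then show ?thesis using u(2) by (simp add: le_diff_conv2 add.commute)
qed

text \<open>The lowest of the remaining levels is attained at \<open>u j\<close>.  The second component passes this
  level on its last edge and, before that, for the first time at some \<open>w i\<close>; both chains are cut
  there.\<close>

lemma conn_descents_step: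
  assumes IH: "\<And>w i. \<lbrakk>i \<le> Suc L; A.descends u j; B.descends w i; w 0 = v 0;
        joint_vertex (u j) (w i)\<rbrakk>
      \<Longrightarrow> conn (u 0) (v 0) (u j) (w i) (descent_cost (u 0) j (v 0) i)"
    and u: "A.descends u K" and v: "B.descends v (Suc L)" and start: "joint_vertex (u 0) (v 0)"
    and stop: "joint_vertex (u K) (v (Suc L))"
    and j: "j < K" "\<And>i. i < K \<Longrightarrow> f (u j) \<le> f (u i)" "\<And>i. i < j \<Longrightarrow> f (u j) < f (u i)"
      "\<And>i. i \<le> L \<Longrightarrow> f (u j) \<le> g (v i)"
    and V: "V (u j)"
  shows "conn (u 0) (v 0) (u K) (v (Suc L)) (descent_cost (u 0) K (v 0) (Suc L))"
proof -
  obtain G where G: "B.sloped G" "v L \<in> G" "v (Suc L) \<in> G" by (rule B.descends_last_edge[OF v])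
  have "f (u j) \<in> closed_segment (g (v (Suc L))) (g (v L))"
    using j(4)[of L] A.descends_le[OF u, of j] j(1) joint_vertex_level[OF stop]
    by (simp add: closed_segment_eq_real_ivl)
  then have "f (u j) \<in> g ` G" by (rule B.edge_between[OF B.sloped_edge[OF G(1)] G(3,2)])
  then obtain q where q: "q \<in> G" "g q = f (u j)" by auto
  obtain i w where w: "i \<le> Suc L" "B.descends w i" "w 0 = v 0" "g (w i) = g q"
    "w i = (if i = Suc L then q else v i)" "\<not> V' (v 0) \<Longrightarrow> i = 0 \<Longrightarrow> L = 0"
    using B.descends_cut[OF v B.sloped_edge[OF G(1)] G(2) q(1)] j(4) q(2) by metis
  have joint_w: "joint_vertex (u j) (w i)"
    using B.descends_end_skeletal[OF w(2)] start w(3,4) q(2) V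
    unfolding joint_vertex_def A.skeletal_def by simp
  have joint_q: "joint_vertex (u j) q"
    using V q G(1) unfolding joint_vertex_def A.skeletal_def B.skeletal_def by auto
  have descend: "conn (u 0) (v 0) (u j) (w i) (descent_cost (u 0) j (v 0) i)"
    using IH[OF w(1) A.descends_take[OF u _ j(3)] w(2,3) joint_w] j(1) by simp
  have jump: "conn (u j) (w i) (u j) q (of_bool (i < L) * D')"
  proof (cases "i < L")
    case True
    then show ?thesis using conn_jumpB[OF V joint_w joint_q] by simp
  next
    case False
    then have "w i \<in> G" using w(1,5) q(1) G(2) by (cases "i = L") auto
    then have "w i = q" using B.sloped_inj[OF G(1)] q(1) w(4) by blast
    then show ?thesis using conn_refl by simp
  qed
  have follow: "conn (u j) q (u K) (v (Suc L)) (K - j + of_bool (j + 2 \<le> K) * D)"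
    using conn_follow_descent[OF G(1) q(1) G(3) u] j(1) joint_q stop by simp
  show ?thesis
    by (rule conn_mono[OF conn_trans[OF conn_trans[OF descend jump] follow]])
      (rule descent_cost_add_le; use j(1) V w(1,6) in blast)
qed

text \<open>If the lowest remaining level is attained at a non-vertex, this is the start \<open>u 0\<close> on a single
  edge.\<close>

lemma conn_descents_nonvertex:
  assumes u: "A.descends u K" "0 < K" "\<not> V (u 0)" and v: "B.descends v L" "0 < L"
    and start: "joint_vertex (u 0) (v 0)" and stop: "joint_vertex (u K) (v L)"
    and low: "\<And>i. i < K \<Longrightarrow> f (u 0) \<le> f (u i)"
  shows "conn (u 0) (v 0) (u K) (v L) (descent_cost (u 0) K (v 0) L)"
proof -
  interpret sw: climbing V' E' g d' V E f d swap_dist D' D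
    by (rule climbing_swap)
  have K: "K = 1" using u low[of 1] unfolding A.descends_def by force
  then have "A.descends u (Suc 0)" using u(1) by simp
  then obtain F where F: "A.sloped F" "u 0 \<in> F" "u (Suc 0) \<in> F" by (rule A.descends_last_edge)
  have "sw.conn (v 0) (u 0) (v L) (u (Suc 0)) (L + of_bool (2 \<le> L) * D')"
  proof (rule sw.conn_follow[OF F(1) _ _ F(2,3)])
    show "chain V' E' v L" using v(1) unfolding B.descends_def by blast
    show "\<exists>r\<in>F. f r \<le> g (v i)" if "i \<le> L" for i
      using F(3) B.descends_le[OF v(1) that] joint_vertex_level[OF stop] K
      by (intro bexI[of _ "u (Suc 0)"]) simp_all
  qed (use start stop K in \<open>simp_all add: joint_vertex_swap\<close>)
  then have "conn (u 0) (v 0) (u K) (v L) (L + of_bool (2 \<le> L) * D')"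
    using K conn_swap by simp
  then show ?thesis
    by (rule conn_mono) (use u(3) start K in \<open>auto simp: descent_cost_def joint_vertex_def\<close>)
qed

lemma conn_descents_from_lower:
  assumes IH: "\<And>w i. \<lbrakk>i \<le> L; A.descends u k; B.descends w i; w 0 = v 0; joint_vertex (u k) (w i)\<rbrakk>
      \<Longrightarrow> conn (u 0) (v 0) (u k) (w i) (descent_cost (u 0) k (v 0) i)"
    and u: "A.descends u K" and v: "B.descends v L" "0 < L"
    and start: "joint_vertex (u 0) (v 0)" and stop: "joint_vertex (u K) (v L)"
    and k: "k < K" "\<And>i. i < K \<Longrightarrow> f (u k) \<le> f (u i)" "\<And>i. i < k \<Longrightarrow> f (u k) < f (u i)"
      "\<And>i. i < L \<Longrightarrow> f (u k) \<le> g (v i)"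
  shows "conn (u 0) (v 0) (u K) (v L) (descent_cost (u 0) K (v 0) L)"
proof (cases "V (u k)")
  case True
  obtain L' where L: "L = Suc L'" using v(2) gr0_implies_Suc by blast
  show ?thesis unfolding L
    by (rule conn_descents_step[where j = k]) (use IH u v(1) start stop k True L in auto)
next
  case False
  then have "k = 0" using chain_vertex[of V E u K k] u k(1) unfolding A.descends_def by auto
  then show ?thesis
    using conn_descents_nonvertex[OF u _ _ v start stop] k(1,2) False by simp
qed

lemma conn_descents_0:
  assumes "A.descends u K" "B.descends v L" "joint_vertex (u 0) (v 0)" "joint_vertex (u K) (v L)"
    and "K = 0 \<or> L = 0"
  shows "conn (u 0) (v 0) (u K) (v L) n"
proof -
  have "f (u 0) = g (v 0)" "f (u K) = g (v L)" using assms(3,4) joint_vertex_level by auto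
  then have "K = 0" "L = 0"
    using assms(1,2,5) unfolding A.descends_def B.descends_def by force+
  then show ?thesis using conn_refl by simp
qed

lemma conn_descents:
  assumes "A.descends u K" "B.descends v L" "joint_vertex (u 0) (v 0)" "joint_vertex (u K) (v L)"
  shows "conn (u 0) (v 0) (u K) (v L) (descent_cost (u 0) K (v 0) L)"
  using assms
proof (induction "K + L" arbitrary: u v K L rule: less_induct)
  case less
  show ?case
  proof (cases "K = 0 \<or> L = 0")
    case True
    then show ?thesis by (rule conn_descents_0[OF less.prems])
  next
    case False
    interpret sw: climbing V' E' g d' V E f d swap_dist D' D
      by (rule climbing_swap)
    note swap = joint_vertex_swap conn_swap descent_cost_swap
    obtain k where k: "k < K" "\<forall>i<K. f (u k) \<le> f (u i)" "\<forall>i<k. f (u k) < f (u i)"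
      using ex_first_minimum[of K "\<lambda>i. f (u i)"] False by auto
    obtain l where l: "l < L" "\<forall>i<L. g (v l) \<le> g (v i)" "\<forall>i<l. g (v l) < g (v i)"
      using ex_first_minimum[of L "\<lambda>i. g (v i)"] False by auto
    show ?thesis
    proof (cases "f (u k) \<le> g (v l)")
      case True
      show ?thesis
      proof (rule conn_descents_from_lower[OF _ less.prems(1,2) _ less.prems(3,4) k(1)])
        show "conn (u 0) (v 0) (u k) (w i) (descent_cost (u 0) k (v 0) i)"
          if "i \<le> L" "A.descends u k" "B.descends w i" "w 0 = v 0" "joint_vertex (u k) (w i)"
          for w i
          using less.hyps[of k i u w] that k(1) less.prems(3) by simp
      qed (use False k(2,3) l(2) True in \<open>auto intro: order_trans\<close>)
    next
      case le: False
      have "sw.conn (v 0) (u 0) (v L) (u K) (sw.descent_cost (v 0) L (u 0) K)"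
      proof (rule sw.conn_descents_from_lower[OF _ less.prems(2,1)])
        show "sw.conn (v 0) (u 0) (v l) (w i) (sw.descent_cost (v 0) l (u 0) i)"
          if "i \<le> K" "B.descends v l" "A.descends w i" "w 0 = u 0" "sw.joint_vertex (v l) (w i)"
          for w i
          using less.hyps[of i l w v] that l(1) less.prems(3) by (simp add: swap)
      qed (use less.prems(3,4) False l k(2) le in \<open>auto simp: joint_vertex_swap intro: order_trans\<close>)
      then show ?thesis unfolding swap .
    qed
  qed
qed

definition diam_bound :: nat where
  "diam_bound = d * (D + 1) + d' * (D' + 1) + 1"

lemma conn_between_minima:
  assumes v: "chain V' E' v L" "i \<le> j" "j \<le> L" "\<forall>h\<le>L. g (v i) \<le> g (v h)"
    and joint: "joint_vertex x (v i)" "joint_vertex x (v j)"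
  shows "conn x (v i) x (v j) (j - i + of_bool (i \<noteq> j) * D')"
proof -
  consider (same) "i = j" | (vertex) "i \<noteq> j" "V x" | (edge) "i \<noteq> j" "\<not> V x" by blast
  then show ?thesis
  proof cases
    case same
    then show ?thesis using conn_refl by simp
  next
    case vertex
    show ?thesis by (rule conn_mono[OF conn_jumpB[OF vertex(2) joint]]) (use vertex(1) in simp)
  next
    case edge
    obtain F where F: "A.sloped F" "x \<in> F"
      using joint(1) edge(2) unfolding joint_vertex_def A.skeletal_def by blast
    interpret sw: climbing V' E' g d' V E f d swap_dist D' D
      by (rule climbing_swap)
    have "sw.conn (v (i + 0)) x (v (i + (j - i))) x (j - i + of_bool (2 \<le> j - i) * D')"
    proof (rule sw.conn_follow[OF F(1) _ _ F(2,2)])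
      show "chain V' E' (\<lambda>h. v (i + h)) (j - i)" using chain_drop[OF chain_take[OF v(1,3)]] .
      show "\<exists>r\<in>F. f r \<le> g (v (i + h))" if "h \<le> j - i" for h
        using F(2) joint_vertex_level[OF joint(1)] v(2,3) v(4)[rule_format, of "i + h"] that
        by (intro bexI[of _ x]) auto
    qed (use joint v(2) in \<open>simp_all add: joint_vertex_swap\<close>)
    then have "conn x (v i) x (v j) (j - i + of_bool (2 \<le> j - i) * D')"
      using v(2) by (simp add: conn_swap)
    then show ?thesis by (rule conn_mono) (use edge(1) in simp)
  qed
qed

text \<open>Both ends descend to the lowest level of \<open>v\<close>; there the first component jumps, and the second
  one passes from the first to the last lowest point of \<open>v\<close>.\<close>

lemma conn_valley:
  assumes p: "A.descends p K" "A.descends p' K'" "f (p K) = g (v k)" "f (p' K') = g (v k)"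
    and v: "B.low_route v L" "k \<le> L" "\<forall>h\<le>L. g (v k) \<le> g (v h)"
    and joint: "joint_vertex (p 0) (v 0)" "joint_vertex (p' 0) (v L)"
    and few: "K - of_bool (\<not> V (p 0)) + (K' - of_bool (\<not> V (p' 0))) \<le> d + of_bool (p K = p' K')"
  shows "conn (p 0) (v 0) (p' 0) (v L) diam_bound"
proof -
  obtain i l where il: "i + l \<le> L" and min: "\<forall>h\<le>L. g (v i) \<le> g (v h)"
    and eq: "g (v (L - l)) = g (v i)"
    and V': "V' (v i)" "V' (v (L - l))"
    and descends: "B.descends v i" "B.descends (\<lambda>h. v (L - h)) l"
    by (rule B.low_route_first_last_minimum[OF v(1)])
  have "g (v i) = g (v k)"
    using min v(2) v(3)[rule_format, of i] il by (intro order.antisym) simp_all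
  then have levels: "g (v i) = g (v k)" "g (v (L - l)) = g (v k)" using eq by simp_all
  have joint_lowest: "joint_vertex x y" if "x \<in> {p K, p' K'}" "y \<in> {v i, v (L - l)}" for x y
    using that p(3,4) levels joint V'
      A.descends_end_skeletal[OF p(1)] A.descends_end_skeletal[OF p(2)]
    unfolding joint_vertex_def B.skeletal_def by auto
  have first: "conn (p 0) (v 0) (p K) (v i) (descent_cost (p 0) K (v 0) i)"
    by (rule conn_descents[OF p(1) descends(1) joint(1) joint_lowest]) simp_all
  have jump: "conn (p K) (v i) (p' K') (v i) (of_bool (p K \<noteq> p' K') * D)"
    using conn_jumpA[OF V'(1) joint_lowest joint_lowest] conn_refl by simp
  have pass: "conn (p' K') (v i) (p' K') (v (L - l)) (L - l - i + of_bool (i \<noteq> L - l) * D')"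
    by (rule conn_between_minima[OF B.low_route_chain[OF v(1)] _ _ min])
      (use il joint_lowest in auto)
  have last: "conn (p' 0) (v L) (p' K') (v (L - l)) (descent_cost (p' 0) K' (v L) l)"
    using conn_descents[OF p(2) descends(2)] joint(2) joint_lowest by simp
  have zero: "K = 0 \<Longrightarrow> i = 0" "K' = 0 \<Longrightarrow> l = 0"
    using descends p(3,4) levels joint[THEN joint_vertex_level] unfolding B.descends_def by force+
  have nonvertex: "of_bool (\<not> V' (v 0)) \<le> i" "of_bool (\<not> V' (v L)) \<le> l"
    using V' by (cases "i = 0", auto) (cases "l = 0", auto)
  have one_vertex: "of_bool (\<not> V (p 0)) + of_bool (\<not> V' (v 0)) \<le> (1::nat)"
    "of_bool (\<not> V (p' 0)) + of_bool (\<not> V' (v L)) \<le> (1::nat)"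
    using joint unfolding joint_vertex_def by auto
  have L: "L \<le> d' + of_bool (\<not> V' (v 0)) + of_bool (\<not> V' (v L))"
    using v(1) unfolding B.low_route_def by blast
  show ?thesis
    by (rule conn_mono[OF conn_trans[OF conn_trans[OF conn_trans[OF first jump] pass]
          conn_sym[OF last]]])
      (use valley_cost_le[OF few D_le_1 L il nonvertex zero one_vertex]
        in \<open>simp add: descent_cost_def diam_bound_def\<close>)
qed

lemma conn_low_routes:
  assumes u: "A.low_route u N" and v: "B.low_route v L"
    and joint: "joint_vertex (u 0) (v 0)" "joint_vertex (u N) (v L)"
    and r: "r \<le> N" "V (u r)" "f (u r) \<le> g (v l)" and l: "l \<le> L" "\<forall>h\<le>L. g (v l) \<le> g (v h)"
  shows "conn (u 0) (v 0) (u N) (v L) diam_bound"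
proof -
  have m: "g (v l) \<le> f (u 0)" "g (v l) \<le> f (u N)"
    using l(2)[rule_format, of 0] l(2)[rule_format, of L] joint[THEN joint_vertex_level] by auto
  obtain K p where p: "K \<le> r" "A.descends p K" "p 0 = u 0" "f (p K) = g (v l)"
    by (rule A.first_descent[OF A.low_route_chain[OF u] _ r(1,3) m(1)])
      (use u in \<open>auto simp: A.low_route_def\<close>)
  obtain K' p' where p': "K' \<le> N - r" "A.descends p' K'" "p' 0 = u N" "f (p' K') = g (v l)"
    by (rule A.first_descent[OF chain_rev[OF A.low_route_chain[OF u]], of "N - r" "g (v l)"])
      (use u r m(2) in \<open>auto simp: A.low_route_def\<close>)
  have "N \<le> d + of_bool (\<not> V (u 0)) + of_bool (\<not> V (u N))"
    using u unfolding A.low_route_def by blast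
  moreover have "of_bool (\<not> V (u 0)) \<le> r" using r(2) by (cases "r = 0") auto
  moreover have "of_bool (\<not> V (u N)) \<le> N - r" using r(1,2) by (cases "r = N") auto
  ultimately have "K - of_bool (\<not> V (p 0)) + (K' - of_bool (\<not> V (p' 0))) \<le> d"
    using p(1,3) p'(1,3) r(1) by simp
  then show ?thesis
    using conn_valley[OF p(2) p'(2) p(4) p'(4) v l] joint p(3) p'(3) by simp
qed

lemma diam_bound_swap: "climbing.diam_bound d' d D' D = diam_bound"
  unfolding diam_bound_def climbing.diam_bound_def[OF climbing_swap]
  by (simp add: add.commute add.left_commute)

lemma conn_low:
  assumes joint: "joint_vertex x y" "joint_vertex x' y'"
    and "A.low x" "A.low x'" "B.low y" "B.low y'"
  shows "conn x y x' y' diam_bound"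
proof -
  obtain u N where u: "A.low_route u N" "u 0 = x" "u N = x'" by (rule A.ex_low_route[OF assms(3,4)])
  obtain v L where v: "B.low_route v L" "v 0 = y" "v L = y'" by (rule B.ex_low_route[OF assms(5,6)])
  obtain r where r: "r \<le> N" "\<forall>h\<le>N. f (u r) \<le> f (u h)" "V (u r)" "A.descends u r"
    by (rule A.low_route_minimum[OF u(1)])
  obtain l where l: "l \<le> L" "\<forall>h\<le>L. g (v l) \<le> g (v h)" "V' (v l)" "B.descends v l"
    by (rule B.low_route_minimum[OF v(1)])
  show ?thesis
  proof (cases "f (u r) \<le> g (v l)")
    case True
    then show ?thesis using conn_low_routes[OF u(1) v(1) _ _ r(1,3) _ l(1,2)] joint u v by simp
  next
    case False
    interpret sw: climbing V' E' g d' V E f d swap_dist D' D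
      by (rule climbing_swap)
    have "sw.conn (v 0) (u 0) (v L) (u N) sw.diam_bound"
      using sw.conn_low_routes[OF v(1) u(1) _ _ l(1,3) _ r(1,2)] False joint u v
      by (simp add: joint_vertex_swap)
    then show ?thesis using u v by (simp add: conn_swap diam_bound_swap)
  qed
qed

text \<open>The edge through \<open>x\<close> is unbounded below, so \<open>x\<close> descends on it to the lowest level of \<open>v\<close>, at
  \<open>q\<close>, and a chain from \<open>x'\<close> to the vertex of this edge is continued to \<open>q\<close>.  If \<open>x'\<close> descends
  along this whole chain, no jump is needed at \<open>q\<close>.\<close>

lemma conn_ray:
  assumes joint: "joint_vertex x y" "joint_vertex x' y'"
    and "\<not> A.low x" "A.low x'" "B.low y" "B.low y'"
  shows "conn x y x' y' diam_bound"
proof -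
  obtain v L where v: "B.low_route v L" "v 0 = y" "v L = y'" by (rule B.ex_low_route[OF assms(5,6)])
  obtain l where l: "l \<le> L" "\<forall>h\<le>L. g (v l) \<le> g (v h)" "V' (v l)" "B.descends v l"
    by (rule B.low_route_minimum[OF v(1)])
  have m: "g (v l) \<le> f x" "g (v l) \<le> f x'"
    using l(2)[rule_format, of 0] l(2)[rule_format, of L] v joint[THEN joint_vertex_level] by auto
  obtain F w q where F: "A.sloped F" "x \<in> F" "w \<in> F" "V w" "q \<in> F" "f q = g (v l)"
    using A.not_low_ray[OF _ assms(3) m(1)] joint(1) unfolding joint_vertex_def by metis
  obtain K p where p: "K \<le> 1" "A.descends p K" "p 0 = x" "p K = q"
    using A.descends_along_edge[OF F(1,2,5)] F(6) m(1) by metis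
  obtain u n where u: "A.low_route u n" "u 0 = x'" "u n = w"
    using A.ex_low_route[OF assms(4), of w] F(4) unfolding A.low_def by metis
  define u' where "u' = u(Suc n := q)"
  have chain: "chain V E u' (Suc n)"
    unfolding u'_def using chain_snoc[OF A.low_route_chain[OF u(1)]] u(3) F A.sloped_edge by metis
  have steep: "f (u' 1) < f (u' 0)" if "\<not> V (u' 0)"
    using u that unfolding u'_def A.low_route_def by simp
  have u'_ends: "u' 0 = x'" "u' (Suc n) = q" unfolding u'_def using u(2) by simp_all
  obtain K' p' where p': "K' \<le> Suc n" "A.descends p' K'" "p' 0 = u' 0" "f (p' K') = g (v l)"
    "f (u' K') = g (v l) \<longrightarrow> p' K' = u' K'"
    by (rule A.first_descent[OF chain steep order_refl, of "g (v l)"])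
      (use m(2) F(6) u'_ends in simp_all)
  have "n \<le> d + of_bool (\<not> V x')" using u F(4) unfolding A.low_route_def by simp
  moreover have "p K = p' K'" if "K' = Suc n" using p'(5) p(4) F(6) u'_ends that by simp
  moreover have "\<not> V x" using assms(3) unfolding A.low_def by blast
  ultimately have
    "K - of_bool (\<not> V (p 0)) + (K' - of_bool (\<not> V (p' 0))) \<le> d + of_bool (p K = p' K')"
    using p(1,3) p'(1,3) u'_ends(1) by (cases "K' = Suc n") auto
  then have "conn (p 0) (v 0) (p' 0) (v L) diam_bound"
    using conn_valley[OF p(2) p'(2) _ p'(4) v(1) l(1,2)] joint p(3,4) p'(3) u'_ends(1) v F(6)
    by simp
  then show ?thesis using p(3) p'(3) u'_ends(1) v by simp
qed

lemma conn_not_low: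
  assumes joint: "joint_vertex x y" "joint_vertex x' y'"
    and not_low: "\<not> (A.low x \<and> B.low y)" and low': "A.low x'" "B.low y'"
  shows "conn x y x' y' diam_bound"
proof (cases "A.low x")
  case True
  interpret sw: climbing V' E' g d' V E f d swap_dist D' D
    by (rule climbing_swap)
  have "sw.conn y x y' x' sw.diam_bound"
    using sw.conn_ray[OF _ _ _ low'(2) True low'(1)] joint not_low True
    by (simp add: joint_vertex_swap)
  then show ?thesis by (simp add: conn_swap diam_bound_swap)
next
  case False
  then have "B.low y" using joint(1) unfolding joint_vertex_def A.low_def B.low_def by blast
  then show ?thesis by (rule conn_ray[OF joint False low'(1) _ low'(2)])
qed

theorem conn_diam_bound:
  assumes joint: "joint_vertex x y" "joint_vertex x' y'"
  shows "conn x y x' y' diam_bound"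
proof -
  interpret neg: climbing V E "\<lambda>x. - f x" d V' E' "\<lambda>y. - g y" d' \<delta> D D'
    by (rule climbing_uminus)
  have high: "neg.A.low x \<and> neg.B.low y" if "joint_vertex x y" "\<not> (A.low x \<and> B.low y)" for x y
    using that A.low_or_low_uminus[of x] B.low_or_low_uminus[of y]
    unfolding joint_vertex_def A.low_def B.low_def neg.A.low_def neg.B.low_def by blast
  consider (both_low) "A.low x \<and> B.low y" "A.low x' \<and> B.low y'"
    | (second_low) "\<not> (A.low x \<and> B.low y)" "A.low x' \<and> B.low y'"
    | (first_low) "A.low x \<and> B.low y" "\<not> (A.low x' \<and> B.low y')"
    | (none_low) "\<not> (A.low x \<and> B.low y)" "\<not> (A.low x' \<and> B.low y')"
    by blast
  then show ?thesis
  proof cases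
    case both_low
    then show ?thesis using conn_low[OF joint] by blast
  next
    case second_low
    then show ?thesis using conn_not_low[OF joint] by blast
  next
    case first_low
    then show ?thesis using conn_sym[OF conn_not_low[OF joint(2,1)]] by blast
  next
    case none_low
    then show ?thesis
      using neg.conn_low[unfolded joint_vertex_uminus, OF joint] high[OF joint(1)] high[OF joint(2)]
      by blast
  qed
qed

end

section \<open>The combinatorial distance\<close>

abbreviation vertex_of :: "'a::real_vector set \<Rightarrow> 'a \<Rightarrow> bool" where
  "vertex_of P x \<equiv> x extreme_point_of P"

abbreviation collinear_face :: "'a::euclidean_space set \<Rightarrow> 'a set \<Rightarrow> bool" where
  "collinear_face P E \<equiv> E face_of P \<and> collinear E"

abbreviation adj_rel :: "'a::real_vector set \<Rightarrow> ('a \<times> 'a) set" where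
  "adj_rel P \<equiv> {(v, w). vertex_adj P v w}"

lemma vertex_adj_sym: "vertex_adj P v w \<Longrightarrow> vertex_adj P w v"
  unfolding vertex_adj_def by (metis closed_segment_commute)

lemma sym_relpow: "sym r \<Longrightarrow> sym (r ^^ n)" for r :: "('a \<times> 'a) set"
proof (induction n)
  case (Suc n)
  show ?case
  proof (rule symI)
    fix x y assume "(x, y) \<in> r ^^ Suc n"
    then obtain z where "(x, z) \<in> r ^^ n" "(z, y) \<in> r" by auto
    then show "(y, x) \<in> r ^^ Suc n" using Suc by (meson relpow_Suc_I2 symD)
  qed
qed (simp add: sym_Id)

lemma edge_walk_relpow:
  "(\<exists>xs. edge_walk P xs \<and> hd xs = v \<and> last xs = w \<and> length xs - 1 = k)
    \<longleftrightarrow> (v, w) \<in> adj_rel P ^^ k"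
proof
  assume "\<exists>xs. edge_walk P xs \<and> hd xs = v \<and> last xs = w \<and> length xs - 1 = k"
  then obtain xs where "edge_walk P xs" "hd xs = v" "last xs = w" "length xs - 1 = k" by blast
  then show "(v, w) \<in> adj_rel P ^^ k" unfolding relpow_fun_conv edge_walk_def
    by (intro exI[of _ "(!) xs"]) (auto simp: hd_conv_nth last_conv_nth)
next
  assume "(v, w) \<in> adj_rel P ^^ k"
  then obtain h where "h 0 = v" "h k = w" "\<forall>i<k. vertex_adj P (h i) (h (Suc i))"
    unfolding relpow_fun_conv by auto
  then show "\<exists>xs. edge_walk P xs \<and> hd xs = v \<and> last xs = w \<and> length xs - 1 = k"
    by (intro exI[of _ "map h [0..<Suc k]"])
      (auto simp: edge_walk_def hd_conv_nth last_conv_nth nth_map_upt simp del: upt_Suc)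
qed

lemma poly_dist_le_enat_iff:
  "poly_dist P v w \<le> enat n \<longleftrightarrow> (\<exists>k\<le>n. (v, w) \<in> adj_rel P ^^ k)"
proof
  assume "poly_dist P v w \<le> enat n"
  also have "enat n < enat (Suc n)" by simp
  finally obtain xs where "edge_walk P xs" "hd xs = v" "last xs = w" "length xs - 1 < Suc n"
    unfolding poly_dist_def INF_less_iff by auto
  then show "\<exists>k\<le>n. (v, w) \<in> adj_rel P ^^ k"
    unfolding edge_walk_relpow[symmetric] by (intro exI[of _ "length xs - 1"]) auto
next
  assume "\<exists>k\<le>n. (v, w) \<in> adj_rel P ^^ k"
  then obtain xs where xs: "edge_walk P xs" "hd xs = v" "last xs = w" "length xs - 1 \<le> n"
    unfolding edge_walk_relpow[symmetric] by blast
  then have "poly_dist P v w \<le> enat (length xs - 1)"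
    unfolding poly_dist_def by (intro INF_lower) auto
  also have "\<dots> \<le> enat n" using xs by simp
  finally show "poly_dist P v w \<le> enat n" .
qed

lemma enat_le_if_bounds: "(\<And>n. b \<le> enat n \<Longrightarrow> a \<le> enat n) \<Longrightarrow> a \<le> b"
  by (cases b) auto

lemma poly_dist_self [simp]: "poly_dist P v v = 0"
  using poly_dist_le_enat_iff[of P v v 0] by (simp add: zero_enat_def[symmetric])

lemma poly_dist_eq_0_iff: "poly_dist P v w = 0 \<longleftrightarrow> v = w"
  using poly_dist_le_enat_iff[of P v w 0] by (simp add: zero_enat_def[symmetric])

lemma poly_dist_adj: "vertex_adj P v w \<Longrightarrow> poly_dist P v w \<le> 1"
  unfolding one_enat_def poly_dist_le_enat_iff by (intro exI[of _ 1]) simp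

lemma poly_dist_triangle: "poly_dist P u w \<le> poly_dist P u v + poly_dist P v w"
proof (cases "poly_dist P u v"; cases "poly_dist P v w")
  fix m n assume "poly_dist P u v = enat m" "poly_dist P v w = enat n"
  then obtain k l where "k \<le> m" "(u, v) \<in> adj_rel P ^^ k"
    "l \<le> n" "(v, w) \<in> adj_rel P ^^ l"
    by (metis order_refl poly_dist_le_enat_iff)
  then have "poly_dist P u w \<le> enat (m + n)"
    unfolding poly_dist_le_enat_iff by (intro exI[of _ "k + l"]) (auto simp: relpow_add)
  then show ?thesis using \<open>poly_dist P u v = enat m\<close> \<open>poly_dist P v w = enat n\<close> by simp
qed auto

lemma poly_dist_image_le:
  assumes "\<And>v w. vertex_adj S v w \<Longrightarrow> vertex_adj R (h v) (h w)"
  shows "poly_dist R (h v) (h w) \<le> poly_dist S v w"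
proof (rule enat_le_if_bounds)
  fix n assume "poly_dist S v w \<le> enat n"
  then obtain k u where u: "k \<le> n" "u 0 = v" "u k = w" "\<forall>i<k. vertex_adj S (u i) (u (Suc i))"
    unfolding poly_dist_le_enat_iff relpow_fun_conv by auto
  then show "poly_dist R (h v) (h w) \<le> enat n"
    unfolding poly_dist_le_enat_iff relpow_fun_conv
    using assms by (intro exI[of _ k] conjI exI[of _ "h \<circ> u"]) auto
qed

lemma poly_dist_commute_le: "poly_dist P v w \<le> poly_dist P w v"
proof (rule enat_le_if_bounds)
  fix n assume "poly_dist P w v \<le> enat n"
  moreover have "sym (adj_rel P)" using vertex_adj_sym by (auto intro: symI)
  ultimately show "poly_dist P v w \<le> enat n"
    unfolding poly_dist_le_enat_iff by (meson sym_relpow symD)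
qed

lemma poly_dist_commute: "poly_dist P v w = poly_dist P w v"
  by (intro order.antisym poly_dist_commute_le)

lemma poly_dist_le_poly_diam:
  assumes "v extreme_point_of P" "w extreme_point_of P"
  shows "poly_dist P v w \<le> poly_diam P"
  unfolding poly_diam_def using assms by (intro SUP_upper2[of "(v, w)"]) auto

lemma poly_diam_le:
  assumes "\<And>v w. v extreme_point_of P \<Longrightarrow> w extreme_point_of P \<Longrightarrow> poly_dist P v w \<le> d"
  shows "poly_diam P \<le> d"
  unfolding poly_diam_def using assms by (intro SUP_least) auto

lemma poly_dist_chain:
  assumes "poly_dist P v w \<le> enat d" "v extreme_point_of P" "w extreme_point_of P"
  shows "\<exists>n\<le>d. \<exists>u. chain (vertex_of P) (collinear_face P) u n \<and> u 0 = v \<and> u n = w"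
proof -
  obtain n u where u: "n \<le> d" "u 0 = v" "u n = w" "\<forall>i<n. vertex_adj P (u i) (u (Suc i))"
    using assms(1) unfolding poly_dist_le_enat_iff relpow_fun_conv by auto
  have "chain (vertex_of P) (collinear_face P) u n"
    unfolding chain_def
  proof (intro conjI allI impI)
    fix i assume "i < n"
    then have "closed_segment (u i) (u (Suc i)) face_of P"
      using u(4) unfolding vertex_adj_def by blast
    then show "\<exists>E. (E face_of P \<and> collinear E) \<and> u i \<in> E \<and> u (Suc i) \<in> E"
      by (intro exI[of _ "closed_segment (u i) (u (Suc i))"]) auto
  next
    fix i assume "0 < i \<and> i < n"
    then show "u i extreme_point_of P" using u(4) unfolding vertex_adj_def by blast
  qed
  then show ?thesis using u by blast
qed

section \<open>Adjacency and faces\<close>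

lemma vertex_adj_if_collinear_face:
  fixes p q :: "'a::euclidean_space"
  assumes T: "T face_of S" "collinear T" and pq: "p \<in> T" "q \<in> T" "p \<noteq> q"
    and ext: "p extreme_point_of S" "q extreme_point_of S"
  shows "vertex_adj S p q"
proof -
  have extT: "p extreme_point_of T" "q extreme_point_of T"
    using T pq ext extreme_point_of_face by blast+
  have "T = closed_segment p q"
  proof
    show "closed_segment p q \<subseteq> T"
      using T pq face_of_imp_convex closed_segment_subset by blast
    show "T \<subseteq> closed_segment p q"
    proof
      fix z assume z: "z \<in> T"
      have "collinear {p, q, z}" using collinear_subset[OF T(2)] pq z by auto
      then have "between (p, q) z \<or> between (q, z) p \<or> between (z, p) q"
        using collinear_between_cases by blast
      then show "z \<in> closed_segment p q"
        using extT z pq unfolding between_mem_segment extreme_point_of_def open_segment_def by auto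
    qed
  qed
  then show ?thesis using T(1) pq(3) ext unfolding vertex_adj_def by blast
qed

lemma vertex_adj_face_of: "\<lbrakk>F face_of S; vertex_adj F v w\<rbrakk> \<Longrightarrow> vertex_adj S v w"
  unfolding vertex_adj_def using extreme_point_of_face face_of_trans by blast

lemma extreme_point_of_linear_image:
  assumes "linear h" "inj h"
  shows "h x extreme_point_of h ` S \<longleftrightarrow> x extreme_point_of S"
  using face_of_linear_image[OF assms, of "{x}" S] by (simp add: face_of_singleton)

lemma vertex_adj_linear_image:
  assumes "linear h" "inj h" "vertex_adj S v w"
  shows "vertex_adj (h ` S) (h v) (h w)"
  using assms face_of_linear_image[OF assms(1,2), of "closed_segment v w" S]
  unfolding vertex_adj_def closed_segment_linear_image[OF assms(1)]
  by (simp add: extreme_point_of_linear_image inj_eq)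

lemma vertex_adj_Times_singleton:
  fixes S :: "'a::euclidean_space set" and y :: "'b::euclidean_space"
  assumes "vertex_adj S v w"
  shows "vertex_adj (S \<times> {y}) (v, y) (w, y)"
proof -
  have face: "F \<times> {y} face_of S \<times> {y}" if "F face_of S" for F
    using that by (simp add: face_of_Times_eq face_of_refl)
  have "closed_segment (v, y) (w, y) = closed_segment v w \<times> {y}"
    unfolding closed_segment_def by (auto simp: scaleR_left_distrib[symmetric])
  moreover have "{v} \<times> {y} = {(v, y)}" "{w} \<times> {y} = {(w, y)}" by auto
  ultimately show ?thesis
    using assms face[of "closed_segment v w"] face[of "{v}"] face[of "{w}"]
    unfolding vertex_adj_def by (simp add: face_of_singleton)
qed

lemma ex_face_rel_interior:
  fixes K :: "'a::euclidean_space set"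
  assumes "convex K" "x \<in> K"
  obtains T where "T face_of K" "x \<in> rel_interior T"
proof -
  define T where "T = \<Inter>{F. F face_of K \<and> x \<in> F}"
  have K_face: "K face_of K" using assms(1) by (rule face_of_refl)
  have T: "T face_of K" unfolding T_def by (rule face_of_Inter) (use K_face assms(2) in auto)
  have xT: "x \<in> T" unfolding T_def by blast
  have convT: "convex T" using T by (rule face_of_imp_convex)
  have "x \<in> rel_interior T"
  proof (rule ccontr)
    assume "x \<notin> rel_interior T"
    then obtain a where a: "\<And>y. y \<in> T \<Longrightarrow> a \<bullet> x \<le> a \<bullet> y" "\<And>y. y \<in> rel_interior T \<Longrightarrow> a \<bullet> x < a \<bullet> y"
      using supporting_hyperplane_rel_boundary[OF convT xT] by metis
    have "T \<inter> {y. a \<bullet> y = a \<bullet> x} face_of K"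
      using face_of_Int_supporting_hyperplane_ge[OF convT] a(1) T face_of_trans by metis
    then have "T \<subseteq> {y. a \<bullet> y = a \<bullet> x}" using xT unfolding T_def by blast
    then have "rel_interior T = {}" using a(2) rel_interior_subset[of T] by force
    then show False using rel_interior_eq_empty[OF convT] xT by blast
  qed
  then show thesis using that T by blast
qed

lemma rel_interior_extend_beyond:
  fixes T :: "'a::euclidean_space set"
  assumes "convex T" "x \<in> rel_interior T" "z \<in> affine hull T"
  shows "\<exists>r>0. x - r *\<^sub>R (z - x) \<in> T"
proof -
  obtain e where "e > 1" "(1 - e) *\<^sub>R z + e *\<^sub>R x \<in> T"
    using convex_rel_interior_if2 assms by blast
  then show ?thesis by (intro exI[of _ "e - 1"]) (simp add: algebra_simps)
qed

lemma extreme_point_of_direction_eq_0: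
  fixes x d :: "'a::real_vector"
  assumes x: "x extreme_point_of S"
    and r: "0 < r" "x - r *\<^sub>R d \<in> S" and s: "0 < s" "x + s *\<^sub>R d \<in> S"
  shows "d = 0"
proof (rule ccontr)
  assume "d \<noteq> 0"
  define u where "u = r / (r + s)"
  have u: "0 < u" "u < 1" "u * (r + s) = r"
    unfolding u_def using r(1) s(1) by (auto simp: field_simps)
  have "(1 - u) *\<^sub>R (x - r *\<^sub>R d) + u *\<^sub>R (x + s *\<^sub>R d) = x + (u * (r + s) - r) *\<^sub>R d"
    by (simp add: algebra_simps)
  also have "\<dots> = x" using u(3) by simp
  finally have mid: "x = (1 - u) *\<^sub>R (x - r *\<^sub>R d) + u *\<^sub>R (x + s *\<^sub>R d)" ..
  have "(x + s *\<^sub>R d) - (x - r *\<^sub>R d) = (r + s) *\<^sub>R d" by (simp add: algebra_simps)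
  then have "x - r *\<^sub>R d \<noteq> x + s *\<^sub>R d" using \<open>d \<noteq> 0\<close> r(1) s(1)
    by (metis add_pos_pos diff_self less_irrefl scaleR_eq_0_iff)
  then have "x \<in> open_segment (x - r *\<^sub>R d) (x + s *\<^sub>R d)"
    using mid u(1,2) unfolding in_segment by blast
  then show False using x r(2) s(2) unfolding extreme_point_of_def by blast
qed

lemma extreme_point_of_hyperplane_slice:
  fixes K :: "'a::euclidean_space set"
  assumes K: "convex K" and x: "x extreme_point_of (K \<inter> {z. a \<bullet> z = t})"
  obtains T where "T face_of K" "collinear T" "x \<in> T" "T = {x} \<or> \<not> T \<subseteq> {z. a \<bullet> z = t}"
proof -
  have xK: "x \<in> K" "a \<bullet> x = t" using x unfolding extreme_point_of_def by auto
  obtain T where T: "T face_of K" "x \<in> rel_interior T"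
    using ex_face_rel_interior[OF K xK(1)] by blast
  have convT: "convex T" using T(1) by (rule face_of_imp_convex)
  have TK: "T \<subseteq> K" using T(1) by (rule face_of_imp_subset)
  have xT: "x \<in> T" using T(2) rel_interior_subset by blast
  note move = rel_interior_extend_beyond[OF convT T(2)]
  have "y = x" if y: "y \<in> affine hull T" "a \<bullet> y = t" for y
  proof -
    obtain r where r: "0 < r" "x - r *\<^sub>R (y - x) \<in> T" using move y(1) by blast
    have "2 *\<^sub>R x - y \<in> affine hull T"
      using mem_affine[OF affine_affine_hull hull_inc[OF xT] y(1), of 2 "- 1"] by simp
    then obtain s where "0 < s" "x - s *\<^sub>R ((2 *\<^sub>R x - y) - x) \<in> T" using move by blast
    moreover have "x - s *\<^sub>R ((2 *\<^sub>R x - y) - x) = x + s *\<^sub>R (y - x)"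
      by (simp add: algebra_simps scaleR_2)
    ultimately have s: "0 < s" "x + s *\<^sub>R (y - x) \<in> T" by simp_all
    have "a \<bullet> (y - x) = 0" using y(2) xK(2) by (simp add: inner_diff_right)
    then have "x - r *\<^sub>R (y - x) \<in> K \<inter> {z. a \<bullet> z = t}" "x + s *\<^sub>R (y - x) \<in> K \<inter> {z. a \<bullet> z = t}"
      using r(2) s(2) TK xK(2) by (auto simp: inner_diff_right[of a x] inner_add_right)
    then have "y - x = 0" using extreme_point_of_direction_eq_0[OF x] r(1) s(1) by blast
    then show "y = x" by simp
  qed
  then have slice: "affine hull T \<inter> {z. a \<bullet> z = t} = {x}"
    using xT xK(2) by (auto simp: hull_inc)
  have "aff_dim T \<le> 1"
    using aff_dim_affine_Int_hyperplane[of "affine hull T" a t] slice by (auto split: if_splits)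
  then have "collinear T" unfolding collinear_aff_dim .
  moreover have "T = {x}" if "T \<subseteq> {z. a \<bullet> z = t}"
    using that slice xT hull_subset[of T affine] by blast
  ultimately show thesis using that T(1) xT by blast
qed

section \<open>Affine functionals on collinear faces\<close>

definition line_free :: "'a::real_vector set \<Rightarrow> bool" where
  "line_free S \<longleftrightarrow> (\<forall>x u. (\<forall>t. x + t *\<^sub>R u \<in> S) \<longrightarrow> u = 0)"

locale affine_functional =
  fixes k :: real and a :: "'a::euclidean_space" and h :: "'a \<Rightarrow> real"
  assumes h_eq: "h x = k + a \<bullet> x"
begin

lemma h_diff: "h x - h y = a \<bullet> (x - y)"
  unfolding h_eq by (simp add: inner_diff_right)

lemma h_convex_combination: "h ((1 - s) *\<^sub>R x + s *\<^sub>R y) = (1 - s) * h x + s * h y"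
  unfolding h_eq by (simp add: inner_add_right algebra_simps)

lemma collinear_parametrization:
  assumes "collinear E" "\<not> h constant_on E"
  obtains p u where "\<forall>x\<in>E. x = p + h x *\<^sub>R u" "\<forall>t. h (p + t *\<^sub>R u) = t"
proof -
  obtain w where w: "\<And>x y. x \<in> E \<Longrightarrow> y \<in> E \<Longrightarrow> \<exists>c. x - y = c *\<^sub>R w"
    using assms(1) unfolding collinear_def by blast
  obtain p q where pq: "p \<in> E" "q \<in> E" "h p \<noteq> h q" using assms(2) unfolding constant_on_def by metis
  have aw: "a \<bullet> w \<noteq> 0" using w[OF pq(1,2)] h_diff[of p q] pq(3) by auto
  define u where "u = w /\<^sub>R (a \<bullet> w)"
  have au: "a \<bullet> u = 1" unfolding u_def using aw by simp
  show thesis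
  proof
    show "\<forall>x\<in>E. x = p - h p *\<^sub>R u + h x *\<^sub>R u"
    proof
      fix x assume x: "x \<in> E"
      obtain c where c: "x - p = c *\<^sub>R w" using w[OF x pq(1)] by blast
      then have "x - p = (c * (a \<bullet> w)) *\<^sub>R u" unfolding u_def using aw by simp
      moreover have "h x - h p = c * (a \<bullet> w)" unfolding h_diff c by simp
      ultimately show "x = p - h p *\<^sub>R u + h x *\<^sub>R u" by (simp add: algebra_simps)
    qed
    show "\<forall>t. h (p - h p *\<^sub>R u + t *\<^sub>R u) = t"
      unfolding h_eq using au by (simp add: inner_diff_right inner_add_right algebra_simps)
  qed
qed

lemma inj_on_collinear:
  assumes "collinear E" "\<not> h constant_on E"
  shows "inj_on h E"
  using collinear_parametrization[OF assms] by (metis inj_onI)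

lemma convex_image: "convex E \<Longrightarrow> convex (h ` E)"
  unfolding convex_alt by (auto simp: h_convex_combination[symmetric])

lemma closed_image_collinear:
  assumes "collinear E" "\<not> h constant_on E" "closed E"
  shows "closed (h ` E)"
proof -
  obtain p u where pu: "\<forall>x\<in>E. x = p + h x *\<^sub>R u" "\<forall>t. h (p + t *\<^sub>R u) = t"
    by (rule collinear_parametrization[OF assms(1,2)])
  have "h ` E = (\<lambda>t. p + t *\<^sub>R u) -` E"
  proof
    show "h ` E \<subseteq> (\<lambda>t. p + t *\<^sub>R u) -` E" using pu(1) by auto
    show "(\<lambda>t. p + t *\<^sub>R u) -` E \<subseteq> h ` E" using pu(2) by (metis image_eqI subsetI vimageD)
  qed
  moreover have "closed ((\<lambda>t. p + t *\<^sub>R u) -` E)"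
    by (intro closed_vimage assms(3) continuous_intros)
  ultimately show ?thesis by simp
qed

lemma nearest_extreme_point:
  assumes E: "convex E" "closed E" "collinear E" "\<not> h constant_on E" and t: "t \<notin> h ` E"
  obtains v where "v extreme_point_of E" "\<forall>r\<in>E. \<bar>h v - t\<bar> \<le> \<bar>h r - t\<bar>"
proof -
  have "h ` E \<noteq> {}" using E(4) unfolding constant_on_def by auto
  then obtain y where y: "y \<in> h ` E" "\<And>z. z \<in> h ` E \<Longrightarrow> dist t y \<le> dist t z"
    using distance_attains_inf[OF closed_image_collinear[OF E(3,4,2)], of t] by metis
  obtain v where v: "v \<in> E" "h v = y" using y(1) by blast
  have nearest: "\<bar>h v - t\<bar> \<le> \<bar>h r - t\<bar>" if "r \<in> E" for r
    using y(2)[of "h r"] v(2) that by (simp add: dist_real_def abs_minus_commute)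
  have "v extreme_point_of E"
    unfolding extreme_point_of_def
  proof (intro conjI ballI notI v(1))
    fix b c assume bc: "b \<in> E" "c \<in> E" "v \<in> open_segment b c"
    then obtain s where s: "0 < s" "s < 1" "v = (1 - s) *\<^sub>R b + s *\<^sub>R c" "b \<noteq> c"
      unfolding in_segment by auto
    have "h b \<noteq> h c" using inj_on_collinear[OF E(3,4)] bc(1,2) s(4) by (auto dest: inj_onD)
    then have "h v \<in> open_segment (h b) (h c)"
      unfolding in_segment using s(1-3) h_convex_combination by auto
    moreover have "t \<notin> closed_segment (h b) (h c)"
      using convex_image[OF E(1)] bc(1,2) t unfolding convex_contains_segment by blast
    ultimately show False
      using nearest[OF bc(1)] nearest[OF bc(2)]
      by (auto simp: open_segment_eq_real_ivl closed_segment_eq_real_ivl split: if_splits)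
  qed
  then show thesis using that nearest by blast
qed

definition sloped_edge :: "'a set \<Rightarrow> 'a set \<Rightarrow> bool" where
  "sloped_edge P E \<longleftrightarrow> E face_of P \<and> collinear E \<and> \<not> h constant_on E"

definition skeletal :: "'a set \<Rightarrow> 'a \<Rightarrow> bool" where
  "skeletal P x \<longleftrightarrow> x extreme_point_of P \<or> (\<exists>E. sloped_edge P E \<and> x \<in> E)"

lemma skeletal_if_collinear_face:
  assumes "E face_of P" "collinear E" "x \<in> E" "h constant_on E \<Longrightarrow> E = {x}"
  shows "skeletal P x"
  using assms unfolding skeletal_def sloped_edge_def by (auto simp: face_of_singleton)

lemma not_onto_if_line_free:
  assumes "line_free P" "E \<subseteq> P" "collinear E" "\<not> h constant_on E"
  shows "h ` E \<noteq> UNIV"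
proof
  assume onto: "h ` E = UNIV"
  obtain p u where pu: "\<forall>x\<in>E. x = p + h x *\<^sub>R u" "\<forall>t. h (p + t *\<^sub>R u) = t"
    by (rule collinear_parametrization[OF assms(3,4)])
  have "p + t *\<^sub>R u \<in> P" for t
  proof -
    obtain x where "x \<in> E" "h x = t" using onto by (metis UNIV_I imageE)
    then show ?thesis using pu(1) assms(2) by (metis subsetD)
  qed
  then have "u = 0" using assms(1) unfolding line_free_def by blast
  then show False using pu(2)[rule_format, of 0] pu(2)[rule_format, of 1] by simp
qed

lemma level_graph_collinear_faces:
  assumes P: "convex P" "closed P" "line_free P" and d: "poly_diam P \<le> enat d"
  shows "level_graph (vertex_of P) (collinear_face P) h d"
proof
  fix E assume "E face_of P \<and> collinear E"
  then have E: "E face_of P" "collinear E" "convex E" "closed E" "E \<subseteq> P"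
    using face_of_imp_convex face_of_imp_subset face_of_imp_closed[OF P(1,2)] by blast+
  show "convex (h ` E)" using E(3) by (rule convex_image)
  show "inj_on h E" if "\<not> h constant_on E" using E(2) that by (rule inj_on_collinear)
  show "h ` E \<noteq> UNIV" if "\<not> h constant_on E" by (rule not_onto_if_line_free[OF P(3) E(5,2) that])
  show "\<exists>v\<in>E. v extreme_point_of P \<and> (\<forall>r\<in>E. \<bar>h v - t\<bar> \<le> \<bar>h r - t\<bar>)"
    if nonconst: "\<not> h constant_on E" and t: "t \<notin> h ` E" for t
  proof -
    obtain v where "v extreme_point_of E" "\<forall>r\<in>E. \<bar>h v - t\<bar> \<le> \<bar>h r - t\<bar>"
      by (rule nearest_extreme_point[OF E(3,4,2) nonconst t])
    then show ?thesis using extreme_point_of_face[OF E(1)] by blast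
  qed
next
  fix v w assume vw: "v extreme_point_of P" "w extreme_point_of P"
  have "poly_dist P v w \<le> enat d" using poly_dist_le_poly_diam[OF vw] d by (rule order_trans)
  then show "\<exists>n\<le>d. \<exists>u. chain (vertex_of P) (collinear_face P) u n
      \<and> u 0 = v \<and> u n = w"
    using vw by (rule poly_dist_chain)
qed

end

section \<open>Fiber products\<close>

lemma collinear_linear_image:
  assumes "linear h" "collinear S"
  shows "collinear (h ` S)"
proof -
  obtain u where u: "\<And>x y. x \<in> S \<Longrightarrow> y \<in> S \<Longrightarrow> \<exists>c. x - y = c *\<^sub>R u"
    using assms(2) unfolding collinear_def by blast
  have "\<exists>c. h x - h y = c *\<^sub>R h u" if "x \<in> S" "y \<in> S" for x y
    using u[OF that] linear_diff[OF assms(1)] linear_scale[OF assms(1)] by metis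
  then show ?thesis unfolding collinear_def by blast
qed

lemma linear_swap: "linear prod.swap"
  by (rule linearI) auto

lemma collinear_Times_cases:
  assumes "collinear (F \<times> G)" "x \<in> F" "y \<in> G"
  obtains "F = {x}" "collinear G" | "G = {y}" "collinear F"
proof -
  obtain u v where uv: "\<And>z z'. z \<in> F \<times> G \<Longrightarrow> z' \<in> F \<times> G \<Longrightarrow> \<exists>c. z - z' = c *\<^sub>R (u, v)"
    using assms(1) unfolding collinear_def by (metis surj_pair)
  have "F = {x} \<or> G = {y}"
  proof (rule ccontr)
    assume "\<not> ?thesis"
    then obtain x' y' where xy: "x' \<in> F" "x' \<noteq> x" "y' \<in> G" "y' \<noteq> y" using assms(2,3) by blast
    obtain c d where "(x', y) - (x, y) = c *\<^sub>R (u, v)" "(x, y') - (x, y) = d *\<^sub>R (u, v)"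
      using uv[of "(x', y)" "(x, y)"] uv[of "(x, y')" "(x, y)"] xy assms(2,3) by blast
    then show False using xy by (auto simp: zero_prod_def[symmetric])
  qed
  moreover have "collinear F"
    using collinear_linear_image[OF linear_fst assms(1)] assms(3) by (auto split: if_splits)
  moreover have "collinear G"
    using collinear_linear_image[OF linear_snd assms(1)] assms(2) by (auto split: if_splits)
  ultimately show thesis using that by blast
qed

locale fiber_product = A: affine_functional k a f + B: affine_functional l b g
  for k a f l b g
begin

definition fiber :: "'a set \<Rightarrow> 'b set \<Rightarrow> ('a \<times> 'b) set" where
  "fiber P Q = {(x, y). x \<in> P \<and> y \<in> Q \<and> f x = g y}"

lemma fiber_product_swap: "fiber_product l b g k a f" ..

lemma fiber_swap: "fiber_product.fiber g f Q P = prod.swap ` fiber P Q"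
  unfolding fiber_def fiber_product.fiber_def[OF fiber_product_swap] by auto

lemma levels_eq_iff: "f x = g y \<longleftrightarrow> a \<bullet> x - b \<bullet> y = l - k"
  unfolding A.h_eq B.h_eq by (simp add: algebra_simps)

lemma fiber_eq_hyperplane_slice: "fiber P Q = (P \<times> Q) \<inter> {z. (a, - b) \<bullet> z = l - k}"
  unfolding fiber_def levels_eq_iff by auto

lemma fiber_face_of:
  assumes "E face_of P" "G face_of Q"
  shows "fiber E G face_of fiber P Q"
proof -
  have "E \<times> G face_of P \<times> Q" using assms by (simp add: face_of_Times_eq)
  then show ?thesis
    unfolding fiber_eq_hyperplane_slice by (rule face_of_slice[OF _ convex_hyperplane])
qed

lemma collinear_fiber_left:
  assumes "collinear E" "collinear G" "\<not> f constant_on E"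
  shows "collinear (fiber E G)"
proof -
  obtain p u where pu: "\<forall>x\<in>E. x = p + f x *\<^sub>R u" "\<forall>t. f (p + t *\<^sub>R u) = t"
    by (rule A.collinear_parametrization[OF assms(1,3)])
  obtain v where v: "\<And>x y. x \<in> G \<Longrightarrow> y \<in> G \<Longrightarrow> \<exists>c. x - y = c *\<^sub>R v"
    using assms(2) unfolding collinear_def by blast
  have "\<exists>c. (x, y) - (x', y') = c *\<^sub>R ((b \<bullet> v) *\<^sub>R u, v)"
    if z: "(x, y) \<in> fiber E G" "(x', y') \<in> fiber E G" for x y x' y'
  proof -
    have E: "x \<in> E" "x' \<in> E" and G: "y \<in> G" "y' \<in> G" and fg: "f x = g y" "f x' = g y'"
      using z unfolding fiber_def by auto
    obtain c where c: "y - y' = c *\<^sub>R v" using v[OF G] by blast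
    have "x - x' = (p + f x *\<^sub>R u) - (p + f x' *\<^sub>R u)" using pu(1) E by metis
    also have "\<dots> = (g y - g y') *\<^sub>R u" unfolding fg by (simp add: scaleR_diff_left)
    finally have "x - x' = (c * (b \<bullet> v)) *\<^sub>R u" unfolding B.h_diff c by simp
    then show ?thesis using c by (intro exI[of _ c]) simp
  qed
  then show ?thesis unfolding collinear_def by (metis surj_pair)
qed

lemma collinear_fiber:
  assumes "collinear E" "collinear G" "\<not> f constant_on E \<or> \<not> g constant_on G"
  shows "collinear (fiber E G)"
proof (cases "f constant_on E")
  case True
  interpret sw: fiber_product l b g k a f by (rule fiber_product_swap)
  have "collinear (prod.swap ` fiber E G)"
    using sw.collinear_fiber_left[OF assms(2,1)] True assms(3) unfolding fiber_swap by blast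
  then have "collinear (prod.swap ` prod.swap ` fiber E G)"
    by (rule collinear_linear_image[OF linear_swap])
  then show ?thesis by (simp add: image_image)
next
  case False
  then show ?thesis by (rule collinear_fiber_left[OF assms(1,2)])
qed

lemma extreme_point_of_fiberI:
  assumes "E face_of P" "G face_of Q" "(x, y) \<in> fiber E G"
    and "\<And>x' y'. (x', y') \<in> fiber E G \<Longrightarrow> x' = x \<and> y' = y"
  shows "(x, y) extreme_point_of fiber P Q"
proof -
  have "fiber E G = {(x, y)}" using assms(3) by (auto dest: assms(4))
  then show ?thesis using fiber_face_of[OF assms(1,2)] by (simp add: face_of_singleton)
qed

lemma extreme_point_of_fiber_left:
  assumes "x extreme_point_of P" "B.skeletal Q y" "f x = g y"
  shows "(x, y) extreme_point_of fiber P Q"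
proof -
  consider (vertex) "y extreme_point_of Q" | (edge) G where "B.sloped_edge Q G" "y \<in> G"
    using assms(2) unfolding B.skeletal_def by blast
  then show ?thesis
  proof cases
    case vertex
    show ?thesis
      by (rule extreme_point_of_fiberI[of "{x}" P "{y}" Q])
        (use vertex assms(1,3) in \<open>auto simp: face_of_singleton fiber_def\<close>)
  next
    case edge
    then have "inj_on g G" using B.inj_on_collinear unfolding B.sloped_edge_def by blast
    then show ?thesis
      by (intro extreme_point_of_fiberI[of "{x}" P G Q])
        (use edge assms(1,3)
          in \<open>auto simp: face_of_singleton fiber_def B.sloped_edge_def dest: inj_onD\<close>)
  qed
qed

lemma extreme_point_of_fiberD:
  assumes P: "convex P" and Q: "convex Q" and xy: "(x, y) extreme_point_of fiber P Q"
  shows "f x = g y" "A.skeletal P x" "B.skeletal Q y" "x extreme_point_of P \<or> y extreme_point_of Q"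
proof -
  show fg: "f x = g y" using xy unfolding extreme_point_of_def fiber_def by auto
  obtain T where T: "T face_of P \<times> Q" "collinear T" "(x, y) \<in> T"
    "T = {(x, y)} \<or> \<not> T \<subseteq> {z. (a, - b) \<bullet> z = l - k}"
    by (rule extreme_point_of_hyperplane_slice[OF convex_Times[OF P Q]
          xy[unfolded fiber_eq_hyperplane_slice]])
  obtain F G where FG: "F face_of P" "G face_of Q" "T = F \<times> G"
    using T(1) unfolding face_of_Times_decomp by blast
  have xy_in: "x \<in> F" "y \<in> G" using T(3) FG(3) by auto
  consider (left) "F = {x}" "collinear G" | (right) "G = {y}" "collinear F"
    using collinear_Times_cases[of F G x y] T(2) xy_in unfolding FG(3) by blast
  then have "x extreme_point_of P \<and> B.skeletal Q y \<or> y extreme_point_of Q \<and> A.skeletal P x"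
  proof cases
    case left
    have "G = {y}" if "g constant_on G"
      using that T(4) fg xy_in unfolding FG(3) left(1) constant_on_def
      by (auto simp: levels_eq_iff[symmetric])
    then show ?thesis
      using B.skeletal_if_collinear_face[OF FG(2) left(2) xy_in(2)]
        FG(1) left(1) face_of_singleton by blast
  next
    case right
    have "F = {x}" if "f constant_on F"
      using that T(4) fg xy_in unfolding FG(3) right(1) constant_on_def
      by (auto simp: levels_eq_iff[symmetric])
    then show ?thesis
      using A.skeletal_if_collinear_face[OF FG(1) right(2) xy_in(1)]
        FG(2) right(1) face_of_singleton by blast
  qed
  then show "A.skeletal P x" "B.skeletal Q y" "x extreme_point_of P \<or> y extreme_point_of Q"
    unfolding A.skeletal_def B.skeletal_def by blast+
qed

lemma extreme_point_of_fiber_iff: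
  assumes "convex P" "convex Q"
  shows "(x, y) extreme_point_of fiber P Q \<longleftrightarrow> f x = g y \<and> A.skeletal P x \<and> B.skeletal Q y
    \<and> (x extreme_point_of P \<or> y extreme_point_of Q)"
proof
  assume rhs: "f x = g y \<and> A.skeletal P x \<and> B.skeletal Q y
    \<and> (x extreme_point_of P \<or> y extreme_point_of Q)"
  show "(x, y) extreme_point_of fiber P Q"
  proof (cases "x extreme_point_of P")
    case True
    then show ?thesis using rhs extreme_point_of_fiber_left by blast
  next
    case False
    interpret sw: fiber_product l b g k a f by (rule fiber_product_swap)
    have "(y, x) extreme_point_of prod.swap ` fiber P Q"
      using sw.extreme_point_of_fiber_left[of y Q P x] rhs False unfolding fiber_swap by simp
    then show ?thesis
      using extreme_point_of_linear_image[OF linear_swap inj_swap, of "(x, y)"] by simp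
  qed
qed (use extreme_point_of_fiberD[OF assms] in blast)

lemma poly_dist_tandem:
  assumes E: "E face_of P" "collinear E" "x \<in> E" "x' \<in> E"
    and G: "G face_of Q" "collinear G" "y \<in> G" "y' \<in> G"
    and sloped: "\<not> f constant_on E \<or> \<not> g constant_on G"
    and ext: "(x, y) extreme_point_of fiber P Q" "(x', y') extreme_point_of fiber P Q"
  shows "poly_dist (fiber P Q) (x, y) (x', y') \<le> 1"
proof (cases "(x, y) = (x', y')")
  case True
  then show ?thesis by simp
next
  case False
  have "(x, y) \<in> fiber E G" "(x', y') \<in> fiber E G"
    using ext E(3,4) G(3,4) unfolding extreme_point_of_def fiber_def by auto
  then show ?thesis
    using vertex_adj_if_collinear_face[OF fiber_face_of[OF E(1) G(1)]
        collinear_fiber[OF E(2) G(2) sloped]]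
      False ext poly_dist_adj by blast
qed

lemma poly_dist_jump_left:
  assumes P: "convex P" and y: "y extreme_point_of Q"
    and ext: "(x, y) extreme_point_of fiber P Q" "(x', y) extreme_point_of fiber P Q"
  shows "poly_dist (fiber P Q) (x, y) (x', y) \<le> poly_diam {x \<in> P. f x = g y}"
proof -
  let ?S = "{x \<in> P. f x = g y}"
  have fiber_slice: "fiber P {y} = ?S \<times> {y}" unfolding fiber_def by auto
  have face: "?S \<times> {y} face_of fiber P Q"
    unfolding fiber_slice[symmetric]
    by (intro fiber_face_of face_of_refl P) (simp add: y face_of_singleton)
  have ext_slice: "z extreme_point_of ?S" if "(z, y) extreme_point_of fiber P Q" for z
  proof -
    have "(z, y) \<in> ?S \<times> {y}" using that unfolding extreme_point_of_def fiber_def by auto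
    then have "{z} \<times> {y} face_of ?S \<times> {y}"
      using that extreme_point_of_face[OF face, of "(z, y)"] by (simp add: face_of_singleton)
    then show ?thesis unfolding face_of_Times_eq by (simp add: face_of_singleton)
  qed
  have "poly_dist (fiber P Q) (x, y) (x', y) \<le> poly_dist ?S x x'"
    by (rule poly_dist_image_le) (intro vertex_adj_face_of[OF face] vertex_adj_Times_singleton)
  also have "\<dots> \<le> poly_diam ?S" by (intro poly_dist_le_poly_diam ext_slice ext)
  finally show ?thesis .
qed

lemma poly_dist_jump_right:
  assumes Q: "convex Q" and x: "x extreme_point_of P"
    and ext: "(x, y) extreme_point_of fiber P Q" "(x, y') extreme_point_of fiber P Q"
  shows "poly_dist (fiber P Q) (x, y) (x, y') \<le> poly_diam {y \<in> Q. g y = f x}"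
proof -
  interpret sw: fiber_product l b g k a f by (rule fiber_product_swap)
  have "(y, x) extreme_point_of prod.swap ` fiber P Q"
    "(y', x) extreme_point_of prod.swap ` fiber P Q"
    using ext extreme_point_of_linear_image[OF linear_swap inj_swap, of _ "fiber P Q"]
    by (metis swap_simp)+
  then have "poly_dist (prod.swap ` fiber P Q) (y, x) (y', x) \<le> poly_diam {y \<in> Q. g y = f x}"
    using sw.poly_dist_jump_left[OF Q x] unfolding fiber_swap by blast
  moreover have
    "poly_dist (prod.swap ` prod.swap ` fiber P Q) (prod.swap (y, x)) (prod.swap (y', x))
      \<le> poly_dist (prod.swap ` fiber P Q) (y, x) (y', x)"
    by (intro poly_dist_image_le vertex_adj_linear_image linear_swap inj_swap)
  ultimately show ?thesis by (simp add: image_image)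
qed

lemma climbing_fiber:
  assumes P: "convex P" "closed P" "line_free P" "poly_diam P \<le> enat d"
      "\<And>t. poly_diam {x \<in> P. f x = t} \<le> enat D"
    and Q: "convex Q" "closed Q" "line_free Q" "poly_diam Q \<le> enat d'"
      "\<And>t. poly_diam {y \<in> Q. g y = t} \<le> enat D'"
    and zero: "d = 0 \<Longrightarrow> D \<le> 1" "d' = 0 \<Longrightarrow> D' \<le> 1"
  shows "climbing (vertex_of P) (collinear_face P) f d (vertex_of Q) (collinear_face Q) g d'
    (poly_dist (fiber P Q)) D D'"
    and "level_graph_pair.joint_vertex (vertex_of P) (collinear_face P) f
      (vertex_of Q) (collinear_face Q) g x y \<longleftrightarrow> (x, y) extreme_point_of fiber P Q"
proof -
  interpret pair: level_graph_pair "vertex_of P" "collinear_face P" f d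
    "vertex_of Q" "collinear_face Q" g d'
    by (intro level_graph_pair.intro A.level_graph_collinear_faces[OF P(1-4)]
        B.level_graph_collinear_faces[OF Q(1-4)])
  have skeletal: "pair.A.skeletal x \<longleftrightarrow> A.skeletal P x" "pair.B.skeletal y \<longleftrightarrow> B.skeletal Q y" for x y
    unfolding pair.A.skeletal_def A.skeletal_def pair.A.sloped_def A.sloped_edge_def
      pair.B.skeletal_def B.skeletal_def pair.B.sloped_def B.sloped_edge_def by auto
  show joint: "pair.joint_vertex x y \<longleftrightarrow> (x, y) extreme_point_of fiber P Q" for x y
    unfolding pair.joint_vertex_def skeletal extreme_point_of_fiber_iff[OF P(1) Q(1)] ..
  show "climbing (vertex_of P) (collinear_face P) f d (vertex_of Q) (collinear_face Q) g d'
    (poly_dist (fiber P Q)) D D'"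
  proof
    show "poly_dist (fiber P Q) (x, y) (x', y') \<le> 1"
      if "pair.joint_vertex x y" "pair.joint_vertex x' y'" "collinear_face P E" "x \<in> E" "x' \<in> E"
        "collinear_face Q G" "y \<in> G" "y' \<in> G"
        "pair.A.sloped E \<or> pair.B.sloped G" for x y x' y' E G
      by (rule poly_dist_tandem[of E P x x' G Q y y'])
        (use that[unfolded joint pair.A.sloped_def pair.B.sloped_def] in auto)
    show "poly_dist (fiber P Q) (x, y) (x', y) \<le> enat D"
      if "y extreme_point_of Q" "pair.joint_vertex x y" "pair.joint_vertex x' y" for x x' y
      by (rule order_trans[OF poly_dist_jump_left[OF P(1)] P(5)])
        (use that[unfolded joint] in auto)
    show "poly_dist (fiber P Q) (x, y) (x, y') \<le> enat D'"
      if "x extreme_point_of P" "pair.joint_vertex x y" "pair.joint_vertex x y'" for x y y'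
      by (rule order_trans[OF poly_dist_jump_right[OF Q(1)] Q(5)])
        (use that[unfolded joint] in auto)
  qed (rule poly_dist_self poly_dist_commute poly_dist_triangle zero; assumption?)+
qed

theorem poly_diam_fiber_le:
  assumes "convex P" "closed P" "line_free P" "poly_diam P \<le> enat d"
    "\<And>t. poly_diam {x \<in> P. f x = t} \<le> enat D"
    and "convex Q" "closed Q" "line_free Q" "poly_diam Q \<le> enat d'"
      "\<And>t. poly_diam {y \<in> Q. g y = t} \<le> enat D'"
    and "d = 0 \<Longrightarrow> D \<le> 1" "d' = 0 \<Longrightarrow> D' \<le> 1"
  shows "poly_diam (fiber P Q) \<le> enat (d * (D + 1) + d' * (D' + 1) + 1)"
proof (rule poly_diam_le)
  fix v w assume ext: "v extreme_point_of fiber P Q" "w extreme_point_of fiber P Q"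
  interpret joint: climbing "vertex_of P" "collinear_face P" f d
    "vertex_of Q" "collinear_face Q" g d'
    "poly_dist (fiber P Q)" D D'
    by (rule climbing_fiber(1)[OF assms])
  have joint_vertex: "joint.joint_vertex x y \<longleftrightarrow> (x, y) extreme_point_of fiber P Q" for x y
    by (rule climbing_fiber(2)[OF assms])
  show "poly_dist (fiber P Q) v w \<le> enat (d * (D + 1) + d' * (D' + 1) + 1)"
    using joint.conn_diam_bound[of "fst v" "snd v" "fst w" "snd w"] ext
    unfolding joint_vertex joint.conn_def joint.diam_bound_def by simp
qed

end

section \<open>Standard-form polyhedra\<close>

lemma convex_std_poly: "convex (std_poly M r)"
  unfolding convex_def std_poly_def
  by (auto simp: matrix_vector_right_distrib matrix_vector_mult_scaleR scaleR_add_left[symmetric])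

lemma closed_std_poly: "closed (std_poly M r)"
proof -
  have "closed {x. M *v x = r}" by (intro closed_Collect_eq continuous_intros)
  moreover have "closed {x::real^'a. \<forall>i. 0 \<le> x $ i}"
    by (intro closed_Collect_all closed_Collect_le continuous_intros)
  ultimately show ?thesis unfolding std_poly_def Collect_conj_eq by (rule closed_Int)
qed

lemma std_poly_nonneg: "x \<in> std_poly M r \<Longrightarrow> 0 \<le> x $ i"
  unfolding std_poly_def by blast

lemma line_free_std_poly: "line_free (std_poly M r)"
  unfolding line_free_def
proof (intro allI impI)
  fix x u assume line: "\<forall>t. x + t *\<^sub>R u \<in> std_poly M r"
  have "u $ i = 0" for i
  proof (rule ccontr)
    assume "u $ i \<noteq> 0"
    moreover have "0 \<le> (x + (- (x $ i + 1) / u $ i) *\<^sub>R u) $ i" using line std_poly_nonneg by blast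
    ultimately show False by simp
  qed
  then show "u = 0" by (simp add: vec_eq_iff)
qed

definition supp :: "real^'n \<Rightarrow> 'n set" where
  "supp x = {i. x $ i \<noteq> 0}"

lemma supp_subset_iff: "supp d \<subseteq> supp x \<longleftrightarrow> (\<forall>i. x $ i = 0 \<longrightarrow> d $ i = 0)"
  unfolding supp_def by blast

lemma ex_nonneg_perturbation:
  fixes x d :: "real^'n"
  assumes "\<And>i. 0 \<le> x $ i" "supp d \<subseteq> supp x"
  obtains e where "0 < e" "\<forall>i t. \<bar>t\<bar> \<le> e \<longrightarrow> 0 \<le> x $ i + t * d $ i"
proof -
  let ?e = "\<lambda>i. if d $ i = 0 then 1 else x $ i / \<bar>d $ i\<bar>"
  define e where "e = Min (range ?e)"
  have pos: "0 < ?e i" for i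
    using assms(1)[of i] assms(2) unfolding supp_subset_iff by (cases "x $ i = 0") auto
  have "e \<in> range ?e" unfolding e_def by (rule Min_in) auto
  then have "0 < e" using pos by blast
  moreover have "0 \<le> x $ i + t * d $ i" if "\<bar>t\<bar> \<le> e" for i t
  proof (cases "d $ i = 0")
    case False
    have "e \<le> ?e i" unfolding e_def by (rule Min_le) auto
    then have "\<bar>t\<bar> \<le> x $ i / \<bar>d $ i\<bar>" using that False by simp
    then have "\<bar>t * d $ i\<bar> \<le> x $ i" using False by (simp add: field_simps abs_mult)
    then show ?thesis by linarith
  qed (use assms(1) in simp)
  ultimately show thesis using that by blast
qed

lemma extreme_point_std_poly_kernel:
  assumes x: "x extreme_point_of std_poly M r" and d: "M *v d = 0" "supp d \<subseteq> supp x"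
  shows "d = 0"
proof -
  have xP: "x \<in> std_poly M r" using x unfolding extreme_point_of_def by blast
  obtain e where e: "0 < e" "\<forall>i t. \<bar>t\<bar> \<le> e \<longrightarrow> 0 \<le> x $ i + t * d $ i"
    using ex_nonneg_perturbation[OF std_poly_nonneg[OF xP] d(2)] by blast
  have "x + t *\<^sub>R d \<in> std_poly M r" if "\<bar>t\<bar> \<le> e" for t
    using xP d(1) e(2) that unfolding std_poly_def
    by (simp add: matrix_vector_right_distrib matrix_vector_mult_scaleR)
  from this[of "- e"] this[of e] show ?thesis
    using extreme_point_of_direction_eq_0[OF x e(1) _ e(1)] e(1) by simp
qed

lemma support_face_of_std_poly:
  "{z \<in> std_poly M r. supp z \<subseteq> supp x} face_of std_poly M r"
  unfolding face_of_def
proof (intro conjI ballI impI)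
  let ?E = "{z \<in> std_poly M r. supp z \<subseteq> supp x}"
  show "?E \<subseteq> std_poly M r" by blast
  have "?E = std_poly M r \<inter> {z. \<forall>i. x $ i = 0 \<longrightarrow> z $ i = 0}" unfolding supp_subset_iff by blast
  moreover have "convex {z::real^'a. \<forall>i. x $ i = 0 \<longrightarrow> z $ i = 0}" unfolding convex_def by auto
  ultimately show "convex ?E" using convex_Int[OF convex_std_poly] by (simp only:)
  fix p q z assume pq: "p \<in> std_poly M r" "q \<in> std_poly M r" "z \<in> ?E" "z \<in> open_segment p q"
  then obtain s where s: "p \<noteq> q" "0 < s" "s < 1" "z = (1 - s) *\<^sub>R p + s *\<^sub>R q"
    unfolding in_segment by auto
  have "p $ i = 0 \<and> q $ i = 0" if "x $ i = 0" for i
  proof -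
    have "0 \<le> (1 - s) * p $ i" "0 \<le> s * q $ i"
      using std_poly_nonneg[OF pq(1)] std_poly_nonneg[OF pq(2)] s(2,3) by simp_all
    moreover have "z $ i = 0" using pq(3) that unfolding supp_subset_iff by blast
    then have "(1 - s) * p $ i + s * q $ i = 0" using s(4) by simp
    ultimately show ?thesis using s(2,3) by (auto simp: add_nonneg_eq_0_iff)
  qed
  then show "p \<in> ?E" "q \<in> ?E" using pq(1,2) unfolding supp_subset_iff by blast+
qed

lemma ex_extreme_point_of_face_std_poly:
  assumes S: "S face_of std_poly M r" "x \<in> S"
  shows "\<exists>w\<in>S. w extreme_point_of std_poly M r"
proof -
  have convex: "convex S" using S(1) by (rule face_of_imp_convex)
  have closed: "closed S" using convex_std_poly closed_std_poly S(1) by (rule face_of_imp_closed)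
  have subset: "S \<subseteq> std_poly M r" using S(1) by (rule face_of_imp_subset)
  define C where "C = S \<inter> {z. 1 \<bullet> z \<le> 1 \<bullet> x}"
  have "norm z \<le> 1 \<bullet> x" if "z \<in> C" for z
  proof -
    have "norm z \<le> (\<Sum>i\<in>UNIV. \<bar>z $ i\<bar>)" by (rule norm_le_l1_cart)
    also have "\<dots> = 1 \<bullet> z"
      using that subset std_poly_nonneg[of z M r] unfolding C_def by (auto simp: inner_vec_def)
    finally show ?thesis using that unfolding C_def by simp
  qed
  then have "compact C"
    unfolding compact_eq_bounded_closed C_def bounded_iff
    by (intro conjI closed_Int closed closed_halfspace_le) auto
  moreover have "x \<in> C" using S(2) unfolding C_def by simp
  ultimately obtain m where m: "m \<in> C" "\<forall>z\<in>C. 1 \<bullet> m \<le> 1 \<bullet> z"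
    using continuous_attains_inf[of C "\<lambda>z. 1 \<bullet> z"]
      continuous_on_inner[OF continuous_on_const continuous_on_id] by blast
  let ?F = "S \<inter> {z. 1 \<bullet> z = 1 \<bullet> m}"
  have "1 \<bullet> m \<le> 1 \<bullet> z" if "z \<in> S" for z
    using m that unfolding C_def by (cases "1 \<bullet> z \<le> 1 \<bullet> x") auto
  then have face: "?F face_of S" by (intro face_of_Int_supporting_hyperplane_ge convex) auto
  have "?F = C \<inter> {z. 1 \<bullet> z = 1 \<bullet> m}" using m(1) unfolding C_def by auto
  then have "compact ?F" using \<open>compact C\<close> by (simp add: compact_Int_closed closed_hyperplane)
  moreover have "m \<in> ?F" using m(1) unfolding C_def by simp
  ultimately obtain w where "w extreme_point_of ?F"
    using extreme_point_exists_convex[of ?F] face_of_imp_convex[OF face] by blast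
  then show ?thesis using extreme_point_of_face[OF face] extreme_point_of_face[OF S(1)] by blast
qed

lemma ex_extreme_point_supp_subset:
  assumes "x \<in> std_poly M r"
  obtains w where "w extreme_point_of std_poly M r" "supp w \<subseteq> supp x"
  using ex_extreme_point_of_face_std_poly[OF support_face_of_std_poly, of x M r x] assms by blast

lemma poly_diam_std_poly_le: "poly_diam (std_poly M r) \<le> mat_diam M"
  unfolding mat_diam_def by (rule SUP_upper) simp

lemma stack_below_mult:
  "stack_below A a *v x = r \<longleftrightarrow> A *v x = (\<chi> j. r $ Some j) \<and> a \<bullet> x = r $ None"
  unfolding vec_eq_iff split_option_all by (auto simp: stack_below_def matrix_vector_mul_component)

lemma stack_below_mult_0: "stack_below A a *v x = 0 \<longleftrightarrow> A *v x = 0 \<and> a \<bullet> x = 0"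
  unfolding stack_below_mult by (simp add: vec_eq_iff)

lemma stack_above_eq: "stack_above b B = stack_below B b"
  unfolding stack_above_def stack_below_def ..

lemma std_poly_stack_below:
  "{x \<in> std_poly A r. a \<bullet> x = t} =
    std_poly (stack_below A a) (\<chi> i. case i of None \<Rightarrow> t | Some j \<Rightarrow> r $ j)"
  unfolding std_poly_def stack_below_mult by auto

section \<open>Matrices of diameter zero\<close>

definition pos_part :: "real^'n \<Rightarrow> real^'n" where
  "pos_part z = (\<chi> i. max (z $ i) 0)"

lemma pos_part_nth [simp]: "pos_part z $ i = max (z $ i) 0"
  unfolding pos_part_def by simp

lemma pos_part_diff: "pos_part z - pos_part (- z) = z"
  by (auto simp: vec_eq_iff)

lemma kernel_pos_part:
  assumes A: "mat_diam A = 0" and z: "A *v z = 0"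
  shows "A *v pos_part z = 0"
proof -
  define p n where "p = pos_part z" and "n = pos_part (- z)"
  have "A *v (p - n) = 0" unfolding p_def n_def pos_part_diff by (rule z)
  then have "A *v n = A *v p" by (simp add: matrix_vector_mult_diff_distrib)
  then have pn: "p \<in> std_poly A (A *v p)" "n \<in> std_poly A (A *v p)"
    unfolding std_poly_def p_def n_def by auto
  obtain w where w: "w extreme_point_of std_poly A (A *v p)" "supp w \<subseteq> supp p"
    by (rule ex_extreme_point_supp_subset[OF pn(1)])
  obtain w' where w': "w' extreme_point_of std_poly A (A *v p)" "supp w' \<subseteq> supp n"
    by (rule ex_extreme_point_supp_subset[OF pn(2)])
  have "poly_dist (std_poly A (A *v p)) w w' \<le> 0"
    using poly_dist_le_poly_diam[OF w(1) w'(1)] poly_diam_std_poly_le[of A "A *v p"] A by simp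
  then have "w = w'" by (simp add: poly_dist_eq_0_iff)
  moreover have "p $ i = 0 \<or> n $ i = 0" for i unfolding p_def n_def by auto
  ultimately have "w = 0"
    using w(2) w'(2) unfolding supp_subset_iff by (metis vec_eq_iff zero_index)
  then have "A *v p = 0" using w(1) unfolding extreme_point_of_def std_poly_def by auto
  then show ?thesis unfolding p_def .
qed

lemma kernel_restrict_zeros:
  fixes z w :: "real^'n"
  assumes A: "mat_diam A = 0" and zw: "A *v z = 0" "A *v w = 0" "\<And>i. 0 \<le> w $ i"
  shows "A *v (\<chi> i. if w $ i = 0 then z $ i else 0) = 0"
proof -
  define s where "s = (\<Sum>i\<in>UNIV. \<bar>z $ i\<bar> / w $ i)"
  have s: "\<bar>z $ i\<bar> \<le> s * w $ i" if "w $ i \<noteq> 0" for i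
  proof -
    have "0 < w $ i" using that zw(3)[of i] by simp
    moreover have "\<bar>z $ i\<bar> / w $ i \<le> s" unfolding s_def
      by (rule member_le_sum) (use zw(3) in auto)
    ultimately show ?thesis by (simp add: field_simps)
  qed
  have "(\<chi> i. if w $ i = 0 then z $ i else 0) = pos_part (z - s *\<^sub>R w) - pos_part (- z - s *\<^sub>R w)"
    using s by (force simp: vec_eq_iff max_def abs_le_iff)
  moreover have "A *v (- z) = 0" using zw(1) matrix_vector_mult_diff_distrib[of A 0 z] by simp
  then have "A *v pos_part (z - s *\<^sub>R w) = 0" "A *v pos_part (- z - s *\<^sub>R w) = 0"
    using zw
    by (auto intro!: kernel_pos_part[OF A]
      simp: matrix_vector_mult_diff_distrib matrix_vector_mult_scaleR)
  ultimately show ?thesis by (simp add: matrix_vector_mult_diff_distrib)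
qed

lemma extreme_point_slice_line:
  assumes q: "q extreme_point_of std_poly (stack_below A a) r"
    and u: "A *v u = 0" "supp u \<subseteq> supp q" "a \<bullet> u \<noteq> 0" and d: "A *v d = 0" "supp d \<subseteq> supp q"
  shows "d = (a \<bullet> d / (a \<bullet> u)) *\<^sub>R u"
proof -
  let ?e = "d - (a \<bullet> d / (a \<bullet> u)) *\<^sub>R u"
  have "stack_below A a *v ?e = 0"
    unfolding stack_below_mult_0 using u(1,3) d(1)
    by (simp add: matrix_vector_mult_diff_distrib matrix_vector_mult_scaleR inner_diff_right)
  moreover have "supp ?e \<subseteq> supp q" using u(2) d(2) unfolding supp_subset_iff by simp
  ultimately have "?e = 0" by (rule extreme_point_std_poly_kernel[OF q])
  then show ?thesis by simp
qed

lemma pos_part_diff_slice_points: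
  assumes A: "mat_diam A = 0"
    and p: "p \<in> std_poly (stack_below A a) r" and q: "q \<in> std_poly (stack_below A a) r"
  shows "A *v pos_part (q - p) = 0" and "supp (pos_part (q - p)) \<subseteq> supp q"
    and "a \<bullet> pos_part (q - p) = a \<bullet> pos_part (p - q)"
proof -
  have kernel: "A *v (q - p) = 0" and level: "a \<bullet> (q - p) = 0"
    using p q unfolding std_poly_def stack_below_mult
    by (auto simp: matrix_vector_mult_diff_distrib inner_diff_right)
  show "A *v pos_part (q - p) = 0" by (rule kernel_pos_part[OF A kernel])
  show "supp (pos_part (q - p)) \<subseteq> supp q"
    unfolding supp_subset_iff using std_poly_nonneg[OF p] by simp
  have "a \<bullet> (pos_part (q - p) - pos_part (p - q)) = 0" using level pos_part_diff[of "q - p"] by simp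
  then show "a \<bullet> pos_part (q - p) = a \<bullet> pos_part (p - q)" by (simp add: inner_diff_right)
qed

lemma pos_part_diff_slice_vertices_level:
  assumes A: "mat_diam A = 0" and "p \<noteq> q"
    and p: "p extreme_point_of std_poly (stack_below A a) r"
    and q: "q extreme_point_of std_poly (stack_below A a) r"
  shows "a \<bullet> pos_part (q - p) \<noteq> 0"
proof
  assume zero: "a \<bullet> pos_part (q - p) = 0"
  have P: "p \<in> std_poly (stack_below A a) r" "q \<in> std_poly (stack_below A a) r"
    using p q unfolding extreme_point_of_def by auto
  have "pos_part (q - p) = 0"
    using extreme_point_std_poly_kernel[OF q] pos_part_diff_slice_points(1,2)[OF A P] zero
    by (simp add: stack_below_mult_0)
  moreover have "pos_part (p - q) = 0"
    using extreme_point_std_poly_kernel[OF p] pos_part_diff_slice_points[OF A P(2,1)] zero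
    by (simp add: stack_below_mult_0)
  ultimately show False using pos_part_diff[of "q - p"] \<open>p \<noteq> q\<close> by simp
qed

lemma kernel_restrict_slice_vertices:
  fixes A :: "real^'n^'m" and p q :: "real^'n"
  assumes A: "mat_diam A = 0" and ne: "p \<noteq> q"
    and p: "p extreme_point_of std_poly (stack_below A a) r"
    and q: "q extreme_point_of std_poly (stack_below A a) r"
    and z: "A *v z = 0" "supp z \<subseteq> supp p \<union> supp q"
  shows "\<exists>c. (\<chi> i. if pos_part (p - q) $ i = 0 then z $ i else 0) = c *\<^sub>R pos_part (q - p)"
    (is "\<exists>c. ?y = c *\<^sub>R _")
proof -
  have pq: "p \<in> std_poly (stack_below A a) r" "q \<in> std_poly (stack_below A a) r"
    using p q unfolding extreme_point_of_def by auto
  note u = pos_part_diff_slice_points(1,2)[OF A pq] pos_part_diff_slice_vertices_level[OF A ne p q]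
  have "A *v ?y = 0"
    by (rule kernel_restrict_zeros[OF A z(1) pos_part_diff_slice_points(1)[OF A pq(2,1)]]) simp
  moreover have "supp ?y \<subseteq> supp q"
    using z(2) std_poly_nonneg[OF pq(1)] unfolding supp_subset_iff
    by (auto simp: supp_def max_def intro: order.antisym)
  ultimately show ?thesis using extreme_point_slice_line[OF q u] by blast
qed

text \<open>If every polyhedron of \<open>A\<close> has at most one vertex, then the kernel of \<open>A\<close> is a vector lattice,
  so \<open>q - p\<close> splits into two disjoint kernel vectors, which span all kernel vectors
  supported on the union of the supports of \<open>p\<close> and \<open>q\<close>.\<close>

lemma kernel_span_slice_vertices:
  fixes A :: "real^'n^'m" and p q :: "real^'n"
  assumes A: "mat_diam A = 0" and ne: "p \<noteq> q"
    and p: "p extreme_point_of std_poly (stack_below A a) r"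
    and q: "q extreme_point_of std_poly (stack_below A a) r"
    and z: "A *v z = 0" "a \<bullet> z = 0" "supp z \<subseteq> supp p \<union> supp q"
  shows "\<exists>c. z = c *\<^sub>R (q - p)"
proof -
  define u v where "u = pos_part (q - p)" and "v = pos_part (p - q)"
  have diff_eq: "u - v = q - p" unfolding u_def v_def using pos_part_diff[of "q - p"] by simp
  have level_eq: "a \<bullet> u = a \<bullet> v"
    using p q pos_part_diff_slice_points(3)[OF A]
    unfolding u_def v_def extreme_point_of_def by blast
  have level_nonzero: "a \<bullet> u \<noteq> 0" unfolding u_def by (rule pos_part_diff_slice_vertices_level[OF A ne p q])
  obtain c where c: "(\<chi> i. if v $ i = 0 then z $ i else 0) = c *\<^sub>R u"
    using kernel_restrict_slice_vertices[OF A ne p q z(1,3)] unfolding u_def v_def by blast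
  obtain c' where c': "(\<chi> i. if u $ i = 0 then z $ i else 0) = c' *\<^sub>R v"
    using kernel_restrict_slice_vertices[OF A ne[symmetric] q p z(1)] z(3)
    unfolding u_def v_def by (auto simp: Un_commute)
  have "z $ i = (c *\<^sub>R u + c' *\<^sub>R v) $ i" for i
  proof (cases "u $ i = 0 \<and> v $ i = 0")
    case True
    then show ?thesis using arg_cong[OF c, of "\<lambda>y. y $ i"] by simp
  next
    case False
    moreover have "u $ i = 0 \<or> v $ i = 0" unfolding u_def v_def by auto
    ultimately show ?thesis unfolding c[symmetric] c'[symmetric] by auto
  qed
  then have decomp: "z = c *\<^sub>R u + c' *\<^sub>R v" unfolding vec_eq_iff by blast
  then have "(c + c') * (a \<bullet> u) = 0" using z(2) level_eq by (simp add: inner_add_right distrib_right)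
  then have "c' = - c" using level_nonzero by simp
  then have "z = c *\<^sub>R (q - p)" unfolding decomp diff_eq[symmetric] by (simp add: scaleR_diff_right)
  then show ?thesis ..
qed

lemma mat_diam_stack_below_le_1:
  assumes A: "mat_diam A = 0"
  shows "mat_diam (stack_below A a) \<le> 1"
  unfolding mat_diam_def
proof (intro SUP_least poly_diam_le)
  fix r p q
  let ?S = "std_poly (stack_below A a) r"
  assume p: "p extreme_point_of ?S" and q: "q extreme_point_of ?S"
  show "poly_dist ?S p q \<le> 1"
  proof (cases "p = q")
    case False
    have pq: "p \<in> ?S" "q \<in> ?S" using p q unfolding extreme_point_of_def by auto
    let ?T = "{z \<in> ?S. supp z \<subseteq> supp (p + q)}"
    have supp_sum: "supp (p + q) = supp p \<union> supp q"
      using std_poly_nonneg[OF pq(1)] std_poly_nonneg[OF pq(2)]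
      unfolding supp_def by (auto simp: add_nonneg_eq_0_iff)
    have "collinear ?T" unfolding collinear_def
    proof (intro exI[of _ "q - p"] ballI)
      fix x y assume xy: "x \<in> ?T" "y \<in> ?T"
      then have "stack_below A a *v (x - y) = 0"
        unfolding std_poly_def by (simp add: matrix_vector_mult_diff_distrib)
      moreover have "supp (x - y) \<subseteq> supp p \<union> supp q"
        using xy unfolding supp_sum[symmetric] by (simp add: supp_subset_iff)
      ultimately show "\<exists>c. x - y = c *\<^sub>R (q - p)"
        using kernel_span_slice_vertices[OF A False p q] unfolding stack_below_mult_0 by blast
    qed
    then have "vertex_adj ?S p q"
      by (rule vertex_adj_if_collinear_face[OF support_face_of_std_poly])
        (use pq supp_sum p q False in auto)
    then show ?thesis by (rule poly_dist_adj)
  qed simp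
qed

section \<open>The 2-sum polyhedron\<close>

lemma poly_diam_two_sum_le:
  fixes A :: "real^'n1^'m1" and B :: "real^'n2^'m2"
  assumes A: "mat_diam A = enat d" "mat_diam (stack_below A a) = enat D"
    and B: "mat_diam B = enat d'" "mat_diam (stack_below B b) = enat D'"
  shows "poly_diam {(x, y). x \<in> std_poly A cA \<and> y \<in> std_poly B cB \<and> a \<bullet> x + b \<bullet> y = c}
    \<le> enat (d * (D + 1) + d' * (D' + 1) + 1)"
proof -
  interpret fiber_product 0 a "\<lambda>x. a \<bullet> x" c "- b" "\<lambda>y. c - b \<bullet> y"
    by unfold_locales simp_all
  have slice: "poly_diam {x \<in> std_poly A cA. a \<bullet> x = t} \<le> enat D" for t
    unfolding std_poly_stack_below A(2)[symmetric] by (rule poly_diam_std_poly_le)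
  have "{y \<in> std_poly B cB. c - b \<bullet> y = t} = {y \<in> std_poly B cB. b \<bullet> y = c - t}" for t by auto
  then have slice': "poly_diam {y \<in> std_poly B cB. c - b \<bullet> y = t} \<le> enat D'" for t
    unfolding std_poly_stack_below B(2)[symmetric] by (simp only: poly_diam_std_poly_le)
  have zero: "d = 0 \<Longrightarrow> D \<le> 1" "d' = 0 \<Longrightarrow> D' \<le> 1"
    using mat_diam_stack_below_le_1[of A a] mat_diam_stack_below_le_1[of B b] A B
    by (simp_all add: zero_enat_def one_enat_def)
  have "poly_diam (fiber (std_poly A cA) (std_poly B cB)) \<le> enat (d * (D + 1) + d' * (D' + 1) + 1)"
    using poly_diam_std_poly_le[of A cA] poly_diam_std_poly_le[of B cB] unfolding A(1) B(1)
    by (intro poly_diam_fiber_le convex_std_poly closed_std_poly line_free_std_poly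
        slice slice' zero)
  moreover have "fiber (std_poly A cA) (std_poly B cB)
      = {(x, y). x \<in> std_poly A cA \<and> y \<in> std_poly B cB \<and> a \<bullet> x + b \<bullet> y = c}"
    unfolding fiber_def by auto
  ultimately show ?thesis by simp
qed

lemma finite_mat_diam_stack_below:
  assumes "mat_diam A * (mat_diam (stack_below A a) + 1) \<noteq> \<infinity>"
  obtains d D where "mat_diam A = enat d" "mat_diam (stack_below A a) = enat D"
proof -
  have "mat_diam A \<noteq> \<infinity>" using assms by (auto simp: imult_is_infinity)
  moreover have "mat_diam (stack_below A a) \<noteq> \<infinity>"
  proof (cases "mat_diam A = 0")
    case True
    then have "mat_diam (stack_below A a) \<le> 1" by (rule mat_diam_stack_below_le_1)
    then show ?thesis by (cases "mat_diam (stack_below A a)") (simp_all add: one_enat_def)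
  next
    case False
    then show ?thesis
      using assms by (cases "mat_diam (stack_below A a)") (auto simp: imult_is_infinity)
  qed
  ultimately show thesis using that by auto
qed

theorem theorem1:
  fixes A :: "real^'n1^'m1" and a :: "real^'n1"
    and b :: "real^'n2" and B :: "real^'n2^'m2"
    and cA :: "real^'m1" and cB :: "real^'m2" and c :: real
  assumes "a \<noteq> 0" and "b \<noteq> 0"
  defines "R \<equiv> {(x, y). A *v x = cA \<and> a \<bullet> x + b \<bullet> y = c \<and> B *v y = cB
                     \<and> (\<forall>i. 0 \<le> x $ i) \<and> (\<forall>j. 0 \<le> y $ j)}"
  shows "poly_diam R \<le> mat_diam A * (mat_diam (stack_below A a) + 1)
                      + mat_diam B * (mat_diam (stack_above b B) + 1)
                      + min (mat_diam (stack_below A a) + mat_diam B + 1)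
                            (mat_diam A + mat_diam (stack_above b B) + 1)"
proof (cases "mat_diam A * (mat_diam (stack_below A a) + 1) = \<infinity>
    \<or> mat_diam B * (mat_diam (stack_above b B) + 1) = \<infinity>")
  case True
  then show ?thesis by auto
next
  case False
  then have finite: "mat_diam A * (mat_diam (stack_below A a) + 1) \<noteq> \<infinity>"
    "mat_diam B * (mat_diam (stack_below B b) + 1) \<noteq> \<infinity>"
    unfolding stack_above_eq by auto
  obtain d D where A: "mat_diam A = enat d" "mat_diam (stack_below A a) = enat D"
    by (rule finite_mat_diam_stack_below[OF finite(1)])
  obtain d' D' where B: "mat_diam B = enat d'" "mat_diam (stack_below B b) = enat D'"
    by (rule finite_mat_diam_stack_below[OF finite(2)])
  have "R = {(x, y). x \<in> std_poly A cA \<and> y \<in> std_poly B cB \<and> a \<bullet> x + b \<bullet> y = c}"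
    unfolding R_def std_poly_def by auto
  then have "poly_diam R \<le> enat (d * (D + 1) + d' * (D' + 1) + 1)"
    using poly_diam_two_sum_le[OF A B] by simp
  also have "\<dots> \<le> enat d * (enat D + 1) + enat d' * (enat D' + 1)
      + min (enat D + enat d' + 1) (enat d + enat D' + 1)"
    by (simp add: one_enat_def)
  finally show ?thesis unfolding stack_above_eq A B .
qed

end
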